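(* Let $M_n$, $n\ge1$, be random measures on a Polish space $\mathbb S$ such that $M_n\to M$ in distribution (with respect to the vague topology) as $n\to\infty$. If every $M_n$ is negatively associated, then $M$ is negatively associated; if every $M_n$ is positively associated, then $M$ is positively associated.
   Context: $\mathbb S$ is Polish with a fixed complete metric; bounded sets refer to this metric. $\mathbf M(\mathbb S)$ is the space of measures finite on bounded Borel sets, with the vague topology: $\mu_n\to\mu$ iff $\int f\,d\mu_n\to\int f\,d\mu$ for every continuous $f:\mathbb S\to\mathbb R_+$ with bounded support; it carries the partial order $\mu<\nu$ iff $\mu(B)\le\nu(B)$ for all bounded Borel $B$. A random measure is a random element of $\mathbf M(\mathbb S)$. A measurable $f$ on $\mathbf M(\mathbb S)$ is measurable with respect to a Borel set $A$ if $f(\mu)=f(\mu(\cdot\cap A))$ for all $\mu$. $M$ is positively associated (PA) if $\mathbb E[f(M)g(M)]\ge\mathbb E[f(M)]\mathbb E[g(M)]$ for all bounded measurable non-decreasing (w.r.t. $<$) $f,g$; it is negatively associated (NA) if $\mathbb E[f(M)g(M)]\le\mathbb E[f(M)]\mathbb E[g(M)]$ for all bounded measurable non-decreasing $f,g$ measurable with respect to disjoint Borel sets $A,B$ respectively. *)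

theory Defs
  imports "HOL-Probability.Probability"
begin

text \<open>The Polish space S is a type of class polish_space; its metric is dist
  (a complete metric); bounded sets are those that are bounded for dist.\<close>

definition locfin_measures :: "('a::polish_space) measure set" where
  "locfin_measures = {\<mu>. sets \<mu> = sets borel \<and>
      (\<forall>B \<in> sets borel. bounded B \<longrightarrow> emeasure \<mu> B < \<infinity>)}"

definition vague_test_fun :: "('a::polish_space \<Rightarrow> real) \<Rightarrow> bool" where
  "vague_test_fun f \<longleftrightarrow> continuous_on UNIV f \<and> (\<forall>x. 0 \<le> f x) \<and>
      bounded (range f) \<and> bounded {x. f x \<noteq> 0}"

definition vague_topology :: "('a::polish_space) measure topology" where
  "vague_topology = subtopology
     (topology_generated_by
        {{\<mu>. (\<integral>x. f x \<partial>\<mu>) \<in> U} | f U. vague_test_fun f \<and> open U})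
     locfin_measures"

definition RM_space :: "('a::polish_space) measure measure" where
  "RM_space = sigma locfin_measures
     {{\<mu> \<in> locfin_measures. emeasure \<mu> B \<le> t} | B t. B \<in> sets borel \<and> bounded B}"

definition meas_le :: "('a::polish_space) measure \<Rightarrow> 'a measure \<Rightarrow> bool" where
  "meas_le \<mu> \<nu> \<longleftrightarrow> (\<forall>B \<in> sets borel. bounded B \<longrightarrow> emeasure \<mu> B \<le> emeasure \<nu> B)"

definition bdd_mono_functional :: "(('a::polish_space) measure \<Rightarrow> real) \<Rightarrow> bool" where
  "bdd_mono_functional f \<longleftrightarrow> f \<in> borel_measurable RM_space \<and>
      (\<exists>C. \<forall>\<mu> \<in> locfin_measures. \<bar>f \<mu>\<bar> \<le> C) \<and>
      (\<forall>\<mu> \<in> locfin_measures. \<forall>\<nu> \<in> locfin_measures. meas_le \<mu> \<nu> \<longrightarrow> f \<mu> \<le> f \<nu>)"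

text \<open>Restriction mu(. inter A), and measurability of a functional w.r.t. A.\<close>
definition restr_meas :: "('a::polish_space) measure \<Rightarrow> 'a set \<Rightarrow> 'a measure" where
  "restr_meas \<mu> A = density \<mu> (indicator A)"

definition functional_on :: "(('a::polish_space) measure \<Rightarrow> real) \<Rightarrow> 'a set \<Rightarrow> bool" where
  "functional_on f A \<longleftrightarrow> (\<forall>\<mu> \<in> locfin_measures. f \<mu> = f (restr_meas \<mu> A))"

definition random_measure :: "'b measure \<Rightarrow> ('b \<Rightarrow> ('a::polish_space) measure) \<Rightarrow> bool" where
  "random_measure \<Omega> X \<longleftrightarrow> prob_space \<Omega> \<and> X \<in> measurable \<Omega> RM_space"

definition pos_assoc :: "'b measure \<Rightarrow> ('b \<Rightarrow> ('a::polish_space) measure) \<Rightarrow> bool" where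
  "pos_assoc \<Omega> X \<longleftrightarrow> (\<forall>f g. bdd_mono_functional f \<and> bdd_mono_functional g \<longrightarrow>
      (\<integral>\<omega>. f (X \<omega>) * g (X \<omega>) \<partial>\<Omega>) \<ge> (\<integral>\<omega>. f (X \<omega>) \<partial>\<Omega>) * (\<integral>\<omega>. g (X \<omega>) \<partial>\<Omega>))"

definition neg_assoc :: "'b measure \<Rightarrow> ('b \<Rightarrow> ('a::polish_space) measure) \<Rightarrow> bool" where
  "neg_assoc \<Omega> X \<longleftrightarrow> (\<forall>f g A B. bdd_mono_functional f \<and> bdd_mono_functional g \<and>
      A \<in> sets borel \<and> B \<in> sets borel \<and> A \<inter> B = {} \<and>
      functional_on f A \<and> functional_on g B \<longrightarrow>
      (\<integral>\<omega>. f (X \<omega>) * g (X \<omega>) \<partial>\<Omega>) \<le> (\<integral>\<omega>. f (X \<omega>) \<partial>\<Omega>) * (\<integral>\<omega>. g (X \<omega>) \<partial>\<Omega>))"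

definition conv_distr ::
  "(nat \<Rightarrow> 'b measure) \<Rightarrow> (nat \<Rightarrow> 'b \<Rightarrow> ('a::polish_space) measure) \<Rightarrow>
   'c measure \<Rightarrow> ('c \<Rightarrow> 'a measure) \<Rightarrow> bool" where
  "conv_distr \<Omega>s Xs \<Omega> X \<longleftrightarrow> (\<forall>F. continuous_map vague_topology euclideanreal F \<and>
      (\<exists>C. \<forall>\<mu> \<in> locfin_measures. \<bar>F \<mu>\<bar> \<le> C) \<longrightarrow>
      (\<lambda>n. \<integral>\<omega>. F (Xs n \<omega>) \<partial>(\<Omega>s n)) \<longlonglongrightarrow> (\<integral>\<omega>. F (X \<omega>) \<partial>\<Omega>))"

end

theory Submission
  imports Defs
begin

text \<open>
  It suffices to approximate, in L1 under the law of the limit M, a bounded monotone functional f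
  measurable with respect to A by monotone, vaguely continuous functionals of finitely many integrals
  of test functions supported near compact subsets of A: for these, the covariance inequality passes
  to the limit, and for disjoint A and B the supports can be kept disjoint.

  By layers, f may be taken to be the indicator of an upper set U. Encode a measure by its values on a
  countable ring of bounded Borel sets in which every set is exhausted from inside by compact members,
  up to sets whose M-mass tends to 0 almost surely. Up to an event of small probability U can then be
  replaced by a compact set K of coordinate sequences, all of which come from measures in U. The upward
  closure of K is a pointwise limit of continuous monotone functions of finitely many coordinates, and
  each coordinate, the mass of a bounded Borel set, is approximated through compact subsets by
  integrals of continuous functions.
\<close>

subsection \<open>Measurability on the space of locally finite measures\<close>

text \<open>A bounded monotone functional is merely measurable, and continuous approximants chosen
  without regard to the order need not be monotone, in which case association of \<open>Ms n\<close>
  says nothing about their covariance. Inner regularity cures this: an upper set that contains a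
  compact set contains its upward closure as well, so passing to the upward closure restores
  monotonicity and loses no mass. The compact set is sought among real sequences because they form a
  Polish space; the price is that its points must be recognised as coordinate sequences of measures,
  and the compact exhaustions inside the ring serve that purpose.

  The second obstacle is locality. Disjoint Borel sets may have closures that meet, so approximation
  from outside could make supports overlap, whereas finitely many compact subsets of A and of B lie
  at a positive distance. All choices, the ring included, depend on the law of the limit alone; only
  afterwards does n tend to infinity.\<close>

lemma space_RM_space: "space RM_space = locfin_measures"
  unfolding RM_space_def by (rule space_measure_of) auto

lemma locfinD:
  assumes "\<mu> \<in> locfin_measures"
  shows "sets \<mu> = sets borel" "space \<mu> = UNIV"
    "B \<in> sets borel \<Longrightarrow> bounded B \<Longrightarrow> emeasure \<mu> B < \<infinity>"
  using assms sets_eq_imp_space_eq[of \<mu> borel] by (auto simp: locfin_measures_def)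

lemma emeasure_RM_measurable:
  assumes "B \<in> sets borel" "bounded B"
  shows "(\<lambda>\<mu>. emeasure \<mu> B) \<in> borel_measurable RM_space"
proof (rule borel_measurableI_le)
  fix t :: ennreal
  have "{\<mu> \<in> locfin_measures. emeasure \<mu> B \<le> t} \<in> sets RM_space"
    unfolding RM_space_def using assms by (intro in_measure_of) auto
  then show "{\<mu> \<in> space RM_space. emeasure \<mu> B \<le> t} \<in> sets RM_space"
    by (simp add: space_RM_space)
qed

lemma measurable_RM_I:
  fixes X :: "'b \<Rightarrow> ('a::polish_space) measure"
  assumes "\<And>\<omega>. \<omega> \<in> space N \<Longrightarrow> X \<omega> \<in> locfin_measures"
    and "\<And>B. B \<in> sets borel \<Longrightarrow> bounded B \<Longrightarrow> (\<lambda>\<omega>. emeasure (X \<omega>) B) \<in> borel_measurable N"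
  shows "X \<in> measurable N RM_space"
  unfolding RM_space_def
proof (rule measurable_measure_of)
  show "X \<in> space N \<rightarrow> locfin_measures" using assms(1) by auto
  fix Y :: "'a measure set" assume "Y \<in> {{\<mu> \<in> locfin_measures. emeasure \<mu> B \<le> t} | B t. B \<in> sets borel \<and> bounded B}"
  then obtain B t where Y: "Y = {\<mu> \<in> locfin_measures. emeasure \<mu> B \<le> t}"
    and B: "B \<in> sets borel" "bounded B" by blast
  have "X -` Y \<inter> space N = {\<omega> \<in> space N. emeasure (X \<omega>) B \<le> t}"
    using assms(1) Y by auto
  then show "X -` Y \<inter> space N \<in> sets N"
    using assms(2)[OF B] by simp
qed auto

lemma emeasure_restr_meas:
  assumes "\<mu> \<in> locfin_measures" "A \<in> sets borel" "B \<in> sets borel"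
  shows "emeasure (restr_meas \<mu> A) B = emeasure \<mu> (A \<inter> B)"
  using assms unfolding restr_meas_def
  by (subst emeasure_density)
     (auto simp: locfinD(1) cong: measurable_cong_sets simp: indicator_inter_arith[symmetric] mult.commute nn_integral_indicator)

lemma restr_meas_locfin:
  assumes "\<mu> \<in> locfin_measures" "A \<in> sets borel"
  shows "restr_meas \<mu> A \<in> locfin_measures"
proof -
  have "sets (restr_meas \<mu> A) = sets borel"
    using assms by (simp add: restr_meas_def locfinD)
  then show ?thesis
    using assms by (auto simp: locfin_measures_def emeasure_restr_meas bounded_Int)
qed

lemma restr_meas_measurable:
  assumes "A \<in> sets borel"
  shows "(\<lambda>\<mu>. restr_meas \<mu> A) \<in> measurable RM_space RM_space"
proof (rule measurable_RM_I)
  fix B :: "'a set" assume B: "B \<in> sets borel" "bounded B"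
  show "(\<lambda>\<mu>. emeasure (restr_meas \<mu> A) B) \<in> borel_measurable RM_space"
    by (subst measurable_cong[where g="\<lambda>\<mu>. emeasure \<mu> (A \<inter> B)"])
       (use assms B in \<open>auto simp: space_RM_space emeasure_restr_meas bounded_Int
          intro!: emeasure_RM_measurable\<close>)
qed (auto simp: space_RM_space restr_meas_locfin assms)

text \<open>The factor \<open>indicator W\<close> keeps the induction over measurable functions on
  bounded sets, whose masses are the generators of \<open>RM_space\<close>.\<close>

lemma nn_integral_RM_measurable:
  assumes "\<phi> \<in> borel_measurable borel" "W \<in> sets borel" "bounded W"
  shows "(\<lambda>\<mu>. \<integral>\<^sup>+x. \<phi> x * indicator W x \<partial>\<mu>) \<in> borel_measurable RM_space"
  using assms(1)
proof (induction rule: borel_measurable_induct)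
  case (cong f g)
  then show ?case by (metis (no_types, lifting) ext UNIV_I space_borel)
next
  case (set A)
  show ?case
    by (subst measurable_cong[where g="\<lambda>\<mu>. emeasure \<mu> (A \<inter> W)"])
       (use set assms in \<open>auto simp: space_RM_space locfinD bounded_Int
         indicator_inter_arith[symmetric] nn_integral_indicator intro!: emeasure_RM_measurable\<close>)
next
  case (mult u c)
  then show ?case
    by (subst measurable_cong[where g="\<lambda>\<mu>. c * (\<integral>\<^sup>+x. u x * indicator W x \<partial>\<mu>)"])
       (use assms in \<open>auto simp: space_RM_space locfinD mult.assoc cong: measurable_cong_sets
         intro!: nn_integral_cmult\<close>)
next
  case (add u v)
  then show ?case
    by (subst measurable_cong[where g="\<lambda>\<mu>. (\<integral>\<^sup>+x. v x * indicator W x \<partial>\<mu>)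
           + (\<integral>\<^sup>+x. u x * indicator W x \<partial>\<mu>)"])
       (use assms in \<open>auto simp: space_RM_space locfinD distrib_right cong: measurable_cong_sets
         intro!: nn_integral_add\<close>)
next
  case (seq U)
  have "(\<integral>\<^sup>+x. (SUP i. U i) x * indicator W x \<partial>\<mu>) = (SUP i. \<integral>\<^sup>+x. U i x * indicator W x \<partial>\<mu>)"
    if "\<mu> \<in> locfin_measures" for \<mu> :: "'a measure"
  proof -
    have "(SUP i. U i) x * indicator W x = (SUP i. U i x * indicator W x)" for x
      by (simp add: SUP_mult_right_ennreal image_comp)
    then show ?thesis
      using that seq assms
      by (subst nn_integral_monotone_convergence_SUP[symmetric])
         (auto simp: locfinD incseq_def le_fun_def cong: measurable_cong_sets
           intro!: mult_right_mono)
  qed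
  then show ?case
    by (subst measurable_cong[where g="\<lambda>\<mu>. (SUP i. \<integral>\<^sup>+x. U i x * indicator W x \<partial>\<mu>)"])
       (use seq in \<open>auto simp: space_RM_space\<close>)
qed

section \<open>Integrals of vague test functions\<close>

lemma vague_test_funD:
  assumes "vague_test_fun f"
  shows "f \<in> borel_measurable borel" "0 \<le> f x"
    "{x. f x \<noteq> 0} \<in> sets borel" "bounded {x. f x \<noteq> 0}" "\<exists>C. \<forall>x. f x \<le> C"
proof -
  show "f \<in> borel_measurable borel" "0 \<le> f x" "bounded {x. f x \<noteq> 0}"
    using assms by (auto simp: vague_test_fun_def intro: borel_measurable_continuous_onI)
  then show "{x. f x \<noteq> 0} \<in> sets borel" by simp
  show "\<exists>C. \<forall>x. f x \<le> C"
    using assms by (auto simp: vague_test_fun_def bounded_real abs_le_iff)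
qed

text \<open>An upper bound of \<open>f\<close> times the finite mass of its bounded support controls
  the integral. The form with the indicator is the one to which
  \<open>nn_integral_RM_measurable\<close> applies.\<close>

lemma vague_test_fun_integral:
  assumes "vague_test_fun f" "\<mu> \<in> locfin_measures"
  shows "integrable \<mu> f"
    "(\<integral>x. f x \<partial>\<mu>) = enn2real (\<integral>\<^sup>+x. ennreal (f x) * indicator {x. f x \<noteq> 0} x \<partial>\<mu>)"
    "(\<integral>\<^sup>+x. ennreal (f x) * indicator {x. f x \<noteq> 0} x \<partial>\<mu>) < \<infinity>"
proof -
  note f = vague_test_funD[OF assms(1)]
  have m: "f \<in> borel_measurable \<mu>"
    using f(1) locfinD(1)[OF assms(2)] by (simp cong: measurable_cong_sets)
  obtain C where C: "\<And>x. f x \<le> C" using f(5) by auto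
  have eq: "(\<lambda>x. ennreal (f x) * indicator {x. f x \<noteq> 0} x) = (\<lambda>x. ennreal (f x))"
    by (auto simp: indicator_def)
  have "(\<integral>\<^sup>+x. ennreal (f x) * indicator {x. f x \<noteq> 0} x \<partial>\<mu>)
      \<le> (\<integral>\<^sup>+x. ennreal C * indicator {x. f x \<noteq> 0} x \<partial>\<mu>)"
    by (intro nn_integral_mono mult_right_mono ennreal_leI C) auto
  also have "\<dots> = ennreal C * emeasure \<mu> {x. f x \<noteq> 0}"
    using f(3) locfinD(1)[OF assms(2)] by (simp add: nn_integral_cmult_indicator)
  also have "\<dots> < \<infinity>"
    using locfinD(3)[OF assms(2) f(3,4)] by (simp add: ennreal_mult_less_top)
  finally show fin: "(\<integral>\<^sup>+x. ennreal (f x) * indicator {x. f x \<noteq> 0} x \<partial>\<mu>) < \<infinity>" .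
  then show "integrable \<mu> f"
    unfolding eq using m f(2) by (intro integrableI_nonneg) auto
  show "(\<integral>x. f x \<partial>\<mu>) = enn2real (\<integral>\<^sup>+x. ennreal (f x) * indicator {x. f x \<noteq> 0} x \<partial>\<mu>)"
    unfolding eq using m f(2) by (intro integral_eq_nn_integral) auto
qed

lemma vague_test_fun_measurable:
  assumes "vague_test_fun f"
  shows "(\<lambda>\<mu>. \<integral>x. f x \<partial>\<mu>) \<in> borel_measurable RM_space"
proof -
  have "(\<lambda>\<mu>. enn2real (\<integral>\<^sup>+x. ennreal (f x) * indicator {x. f x \<noteq> 0} x \<partial>\<mu>))
      \<in> borel_measurable RM_space"
    using vague_test_funD[OF assms]
    by (intro borel_measurable_enn2real nn_integral_RM_measurable) auto
  then show ?thesis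
    by (subst measurable_cong[OF vague_test_fun_integral(2)[OF assms]])
       (auto simp: space_RM_space)
qed

text \<open>\<open>meas_le\<close> compares masses of bounded sets only. After restriction to the
  bounded set \<open>W\<close> where \<open>f\<close> does not vanish, the comparison holds for all
  Borel sets, as monotonicity of the integral in the measure requires.\<close>

lemma vague_test_fun_mono:
  assumes f: "vague_test_fun f" and \<mu>: "\<mu> \<in> locfin_measures" and \<nu>: "\<nu> \<in> locfin_measures"
    and le: "meas_le \<mu> \<nu>"
  shows "(\<integral>x. f x \<partial>\<mu>) \<le> (\<integral>x. f x \<partial>\<nu>)"
proof -
  define W where "W = {x. f x \<noteq> 0}"
  note fD = vague_test_funD[OF f, folded W_def]
  have nn: "(\<integral>\<^sup>+x. ennreal (f x) \<partial>restr_meas \<rho> W) = (\<integral>\<^sup>+x. ennreal (f x) * indicator W x \<partial>\<rho>)"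
    if "\<rho> \<in> locfin_measures" for \<rho>
    using fD(1,3) that unfolding restr_meas_def
    by (subst nn_integral_density) (auto simp: locfinD mult.commute cong: measurable_cong_sets)
  have "restr_meas \<mu> W \<le> restr_meas \<nu> W"
    using le fD(3,4) \<mu> \<nu> restr_meas_locfin[OF \<mu>] restr_meas_locfin[OF \<nu>]
    by (subst le_measure) (auto simp: locfinD emeasure_restr_meas meas_le_def bounded_Int)
  then have "(\<integral>\<^sup>+x. ennreal (f x) * indicator W x \<partial>\<mu>) \<le> (\<integral>\<^sup>+x. ennreal (f x) * indicator W x \<partial>\<nu>)"
    unfolding nn[OF \<mu>, symmetric] nn[OF \<nu>, symmetric]
    using fD(3) \<mu> \<nu> by (intro nn_integral_mono_measure) (auto simp: locfinD restr_meas_locfin)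
  then show ?thesis
    using vague_test_fun_integral[OF f \<mu>] vague_test_fun_integral[OF f \<nu>]
    by (simp add: W_def enn2real_mono)
qed

lemma integral_restr_meas:
  assumes "vague_test_fun f" "\<mu> \<in> locfin_measures" "A \<in> sets borel" "{x. f x \<noteq> 0} \<subseteq> A"
  shows "(\<integral>x. f x \<partial>restr_meas \<mu> A) = (\<integral>x. f x \<partial>\<mu>)"
proof -
  have "(\<integral>x. f x \<partial>restr_meas \<mu> A) = (\<integral>x. f x \<partial>density \<mu> (\<lambda>x. ennreal (indicator A x)))"
    by (simp add: restr_meas_def ennreal_indicator)
  also have "\<dots> = (\<integral>x. indicator A x *\<^sub>R f x \<partial>\<mu>)"
    using vague_test_funD(1)[OF assms(1)] assms(2,3)
    by (subst integral_density) (auto simp: locfinD cong: measurable_cong_sets)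
  also have "\<dots> = (\<integral>x. f x \<partial>\<mu>)"
    using assms(4) by (intro Bochner_Integration.integral_cong) (auto simp: indicator_def)
  finally show ?thesis .
qed

section \<open>Random measures and deterministic compact exhaustions\<close>

lemma random_measureD:
  assumes "random_measure \<Omega> X"
  shows "prob_space \<Omega>" "X \<in> measurable \<Omega> RM_space"
    "\<omega> \<in> space \<Omega> \<Longrightarrow> X \<omega> \<in> locfin_measures"
    "B \<in> sets borel \<Longrightarrow> bounded B \<Longrightarrow> (\<lambda>\<omega>. emeasure (X \<omega>) B) \<in> borel_measurable \<Omega>"
    "B \<in> sets borel \<Longrightarrow> bounded B \<Longrightarrow> (\<lambda>\<omega>. measure (X \<omega>) B) \<in> borel_measurable \<Omega>"
proof -
  show 1: "prob_space \<Omega>" "X \<in> measurable \<Omega> RM_space"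
    using assms by (auto simp: random_measure_def)
  show "\<omega> \<in> space \<Omega> \<Longrightarrow> X \<omega> \<in> locfin_measures"
    using measurable_space[OF 1(2)] by (simp add: space_RM_space)
  show 2: "B \<in> sets borel \<Longrightarrow> bounded B \<Longrightarrow> (\<lambda>\<omega>. emeasure (X \<omega>) B) \<in> borel_measurable \<Omega>"
    by (rule measurable_compose[OF 1(2) emeasure_RM_measurable])
  show "B \<in> sets borel \<Longrightarrow> bounded B \<Longrightarrow> (\<lambda>\<omega>. measure (X \<omega>) B) \<in> borel_measurable \<Omega>"
    unfolding measure_def by (intro borel_measurable_enn2real 2)
qed

text \<open>The sequence is deterministic: the same compact sets serve almost every realisation, so
  they can be adjoined to a countable ring.\<close>

definition compact_exhaustion ::
  "'b measure \<Rightarrow> ('b \<Rightarrow> ('a::polish_space) measure) \<Rightarrow> 'a set \<Rightarrow> (nat \<Rightarrow> 'a set) \<Rightarrow> bool" where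
  "compact_exhaustion \<Omega> X E C \<longleftrightarrow> (\<forall>j. compact (C j)) \<and> (\<forall>j. C j \<subseteq> E) \<and>
     (AE \<omega> in \<Omega>. (\<lambda>j. measure (X \<omega>) (E - C j)) \<longlonglongrightarrow> 0)"

text \<open>The masses of X need not have finite means, so inner regularity is applied to the mean of X on B
  after dividing by 1 + X(B).\<close>

lemma ex_compact_exhaustion:
  fixes X :: "'b \<Rightarrow> ('a::polish_space) measure"
  assumes X: "random_measure \<Omega> X" and B: "B \<in> sets borel" "bounded B"
  shows "\<exists>C. compact_exhaustion \<Omega> X B C"
proof -
  note XD = random_measureD[OF X]
  interpret prob_space \<Omega> by (rule XD(1))
  define w where "w \<omega> E = emeasure (X \<omega>) (E \<inter> B) / (1 + emeasure (X \<omega>) B)" for \<omega> E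
  define L where "L E = (\<integral>\<^sup>+\<omega>. w \<omega> E \<partial>\<Omega>)" for E
  have wm: "(\<lambda>\<omega>. w \<omega> E) \<in> borel_measurable \<Omega>" if "E \<in> sets borel" for E
    unfolding w_def using B that
    by (intro borel_measurable_divide_ennreal borel_measurable_add XD(4)) (auto simp: bounded_Int)
  define N where "N = measure_of UNIV (sets borel) L"
  have L: "emeasure N E = L E" if "E \<in> sets borel" for E
    unfolding N_def
  proof (rule emeasure_measure_of_sigma)
    show "sigma_algebra UNIV (sets (borel :: 'a measure))"
      using sets.sigma_algebra_axioms[of "borel :: 'a measure"] by simp
    show "positive (sets borel) L" by (simp add: positive_def L_def w_def)
    show "countably_additive (sets borel) L"
    proof (rule countably_additiveI)
      fix A :: "nat \<Rightarrow> 'a set"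
      assume A: "range A \<subseteq> sets borel" "disjoint_family A" "(\<Union>i. A i) \<in> sets borel"
      have "(\<Sum>i. L (A i)) = (\<integral>\<^sup>+\<omega>. (\<Sum>i. w \<omega> (A i)) \<partial>\<Omega>)"
        unfolding L_def using A by (intro nn_integral_suminf[symmetric] wm) auto
      also have "\<dots> = L (\<Union>i. A i)"
        unfolding L_def
      proof (rule nn_integral_cong)
        fix \<omega> assume "\<omega> \<in> space \<Omega>"
        then have s: "sets (X \<omega>) = sets borel" using XD(3) locfinD by auto
        have "(\<Sum>i. emeasure (X \<omega>) (A i \<inter> B)) = emeasure (X \<omega>) (\<Union>i. A i \<inter> B)"
          using A B by (intro suminf_emeasure) (auto simp: s disjoint_family_on_def)
        also have "(\<Union>i. A i \<inter> B) = (\<Union>i. A i) \<inter> B" by auto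
        finally show "(\<Sum>i. w \<omega> (A i)) = w \<omega> (\<Union>i. A i)"
          by (simp add: w_def divide_ennreal_def ennreal_suminf_multc)
      qed
      finally show "(\<Sum>i. L (A i)) = L (\<Union>i. A i)" .
    qed
    show "E \<in> sets borel" by fact
  qed
  have sN: "sets N = sets borel" unfolding N_def using sets.sigma_sets_eq[of "borel :: 'a measure"] by simp
  have wle: "w \<omega> E \<le> 1" if "\<omega> \<in> space \<Omega>" for \<omega> E
  proof -
    have s: "sets (X \<omega>) = sets borel" using XD(3)[OF that] locfinD by auto
    have "emeasure (X \<omega>) (E \<inter> B) \<le> 1 + emeasure (X \<omega>) B"
      using B s by (intro order_trans[OF emeasure_mono[of "E \<inter> B" B]]) (auto simp: add_increasing)
    then have "w \<omega> E \<le> (1 + emeasure (X \<omega>) B) / (1 + emeasure (X \<omega>) B)"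
      unfolding w_def by (rule divide_right_mono_ennreal)
    also have "\<dots> \<le> 1"
      using locfinD(3)[OF XD(3)[OF that] B] by (subst ennreal_divide_self) auto
    finally show ?thesis .
  qed
  have Lle: "L E \<le> 1" for E
    using nn_integral_mono[of \<Omega> "\<lambda>\<omega>. w \<omega> E" "\<lambda>_. 1"] wle by (simp add: L_def emeasure_space_1)
  have fin: "emeasure N (space N) \<noteq> \<infinity>"
    using L[of UNIV] Lle[of UNIV] sets_eq_imp_space_eq[OF sN] by (auto simp: top_unique)
  have NB: "emeasure N B = (SUP K\<in>{K. K \<subseteq> B \<and> compact K}. emeasure N K)"
    by (rule inner_regular[OF sN fin B(1)])
  have "\<forall>j. \<exists>K. K \<in> {K. K \<subseteq> B \<and> compact K} \<and> emeasure N B < emeasure N K + ennreal (1 / Suc j)"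
    unfolding Bex_def[symmetric]
    by (intro allI SUP_approx_ennreal[OF _ _ NB])
       (use L[OF B(1)] Lle[of B] in \<open>auto simp: top_unique\<close>)
  from choice[OF this] obtain K where K: "\<And>j. K j \<subseteq> B" "\<And>j. compact (K j)"
    "\<And>j. emeasure N B < emeasure N (K j) + ennreal (1 / Suc j)"
    by auto
  have KB: "K j \<in> sets borel" for j using K(2) by (rule borel_compact)
  \<comment> \<open>Finite unions make the sequence increasing, so the remainders
    \<open>B - C j\<close> decrease to \<open>D\<close> and continuity from above applies for each
    \<open>\<omega>\<close>.\<close>
  define C where "C j = (\<Union>i\<le>j. K i)" for j
  have C: "compact (C j)" "C j \<subseteq> B" for j
    unfolding C_def using K by (auto intro!: compact_UN)
  have CB: "C j \<in> sets borel" for j using C(1) by (rule borel_compact)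
  define D where "D = B - (\<Union>j. C j)"
  have D: "D \<in> sets borel" "D \<subseteq> B" using CB B by (auto simp: D_def)
  have "emeasure N D \<le> ennreal (1 / Suc j)" for j
  proof -
    have "emeasure N D \<le> emeasure N (B - K j)"
      using KB B by (intro emeasure_mono) (auto simp: sN C_def D_def)
    also have "\<dots> = emeasure N B - emeasure N (K j)"
      using KB B K(1) Lle[of "K j"] L[of "K j"] by (intro emeasure_Diff) (auto simp: sN top_unique)
    also have "\<dots> \<le> ennreal (1 / Suc j)"
      using K(3)[of j] L[OF B(1)] Lle[of B]
      by (subst ennreal_minus_le_iff) (auto simp: add.commute less_imp_le top_unique)
    finally show ?thesis .
  qed
  moreover have "(\<lambda>j. ennreal (1 / Suc j)) \<longlonglongrightarrow> ennreal 0"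
    by (rule tendsto_ennrealI[OF LIMSEQ_inverse_real_of_nat[unfolded inverse_eq_divide]])
  ultimately have "emeasure N D \<le> ennreal 0"
    by (intro tendsto_lowerbound[of "\<lambda>j. ennreal (1 / Suc j)" _ sequentially]) auto
  then have "(\<integral>\<^sup>+\<omega>. w \<omega> D \<partial>\<Omega>) = 0"
    using L[OF D(1)] by (simp add: L_def)
  then have "AE \<omega> in \<Omega>. w \<omega> D = 0"
    using wm[OF D(1)] by (simp add: nn_integral_0_iff_AE)
  then have "AE \<omega> in \<Omega>. (\<lambda>j. measure (X \<omega>) (B - C j)) \<longlonglongrightarrow> 0"
    using AE_space
  proof eventually_elim
    case (elim \<omega>)
    note l = locfinD[OF XD(3)[OF elim(2)]]
    \<comment> \<open>The denominator in \<open>w\<close> is finite, so a vanishing quotient forces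
      a vanishing numerator.\<close>
    have "emeasure (X \<omega>) D = 0"
      using elim(1) l(3)[OF B] D(2) by (auto simp: w_def ennreal_divide_eq_0_iff Int_absorb2)
    moreover have "(\<lambda>j. measure (X \<omega>) (B - C j)) \<longlonglongrightarrow> measure (X \<omega>) (\<Inter>j. B - C j)"
    proof (rule Lim_measure_decseq)
      show "decseq (\<lambda>j. B - C j)" by (fastforce simp: decseq_def C_def)
      show "emeasure (X \<omega>) (B - C j) \<noteq> \<infinity>" for j
        using l(3)[of "B - C j"] B CB bounded_subset[OF B(2) Diff_subset] by auto
    qed (use B CB l(1) in auto)
    moreover have "(\<Inter>j. B - C j) = D" by (auto simp: D_def)
    ultimately show ?case by (simp add: measure_def)
  qed
  with C show ?thesis unfolding compact_exhaustion_def by (intro exI[of _ C]) simp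
qed

subsection \<open>Countable rings and coordinates of measures\<close>

text \<open>Indexing by natural numbers turns a measure into a point of the Polish space of real
  sequences; an enumeration may list a set more than once. \<open>open_union\<close> makes the ring
  generate the Borel sets and lets it detect the order of measures, and \<open>cover\<close> reduces
  local finiteness to finiteness on the ring.\<close>

locale borel_ring =
  fixes R :: "nat \<Rightarrow> 'a::polish_space set"
  assumes ring: "ring_of_sets UNIV (range R)"
    and borel: "R i \<in> sets borel"
    and bdd: "bounded (R i)"
    and open_union: "open G \<Longrightarrow> bounded G \<Longrightarrow> \<exists>I. G = (\<Union>i\<in>I. R i)"
    and cover: "bounded B \<Longrightarrow> \<exists>i. B \<subseteq> R i"
begin

sublocale rs: ring_of_sets UNIV "range R" by (rule ring)

definition evals :: "'a measure \<Rightarrow> nat \<Rightarrow> real" where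
  "evals \<mu> = (\<lambda>i. measure \<mu> (R i))"

lemma emeasure_R:
  assumes "\<mu> \<in> locfin_measures"
  shows "emeasure \<mu> (R i) = ennreal (evals \<mu> i)"
  using locfinD(3)[OF assms borel bdd, of i] unfolding evals_def
  by (intro emeasure_eq_ennreal_measure) auto

lemma sigma_sets_R: "sigma_sets UNIV (range R) = sets borel"
proof
  show "sigma_sets UNIV (range R) \<subseteq> sets borel"
    using sets.sigma_sets_subset[of "range R" borel] borel by auto
  have "S \<in> sigma_sets UNIV (range R)" if "open S" for S :: "'a set"
  proof -
    interpret sigma_algebra UNIV "sigma_sets UNIV (range R)"
      by (rule sigma_algebra_sigma_sets) auto
    \<comment> \<open>An open set may be unbounded, while \<open>open_union\<close> speaks of
      bounded ones; hence the cut by balls of integer radius.\<close>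
    have "S \<inter> ball undefined n \<in> sigma_sets UNIV (range R)" for n
    proof -
      obtain I where "S \<inter> ball undefined n = (\<Union>i\<in>I. R i)"
        using open_union[of "S \<inter> ball undefined n"] \<open>open S\<close> by (auto simp: bounded_Int)
      then show ?thesis by (auto intro!: countable_UN'')
    qed
    then have "(\<Union>n::nat. S \<inter> ball undefined (real n)) \<in> sigma_sets UNIV (range R)"
      by (intro countable_UN) auto
    also have "(\<Union>n::nat. S \<inter> ball undefined (real n)) = S"
      using reals_Archimedean2 by auto
    finally show ?thesis .
  qed
  then show "sets borel \<subseteq> sigma_sets UNIV (range R)"
    by (auto simp: borel_def intro!: sigma_sets_mono)
qed

text \<open>Bounded open sets are increasing unions of ring elements; outer regularity does the rest.\<close>

lemma evals_le_imp_meas_le: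
  assumes \<mu>: "\<mu> \<in> locfin_measures" and \<nu>: "\<nu> \<in> locfin_measures"
    and le: "\<And>i. evals \<mu> i \<le> evals \<nu> i"
  shows "meas_le \<mu> \<nu>"
proof -
  have R_le: "emeasure \<mu> E \<le> emeasure \<nu> E" if "E \<in> range R" for E
    using that ennreal_leI[OF le] \<mu> \<nu> by (auto simp: emeasure_R)
  have open_le: "emeasure \<mu> G \<le> emeasure \<nu> G" if G: "open G" "bounded G" for G
  proof -
    obtain I where I: "G = (\<Union>i\<in>I. R i)" using open_union[OF G] by blast
    define E where "E n = (\<Union>i\<in>I \<inter> {..<n}. R i)" for n
    have E: "E n \<in> range R" for n unfolding E_def by (intro rs.finite_UN) auto
    have Eb: "range E \<subseteq> sets borel"
      by (intro image_subsetI subsetD[OF _ E]) (auto intro: borel)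
    have inc: "incseq E" by (fastforce simp: E_def incseq_def)
    have "(\<Union>n. E n) = G" unfolding I E_def by auto
    then have "emeasure \<rho> G = (SUP n. emeasure \<rho> (E n))" if "\<rho> \<in> locfin_measures" for \<rho>
      using SUP_emeasure_incseq[of E \<rho>] Eb inc locfinD(1)[OF that] by simp
    then show ?thesis using \<mu> \<nu> R_le[OF E] by (auto intro!: SUP_mono)
  qed
  have "emeasure \<mu> B \<le> emeasure \<nu> B" if B: "B \<in> sets borel" "bounded B" for B
  proof -
    obtain r where r: "B \<subseteq> ball undefined r"
      using bounded_subset_ballD[OF B(2)] by blast
    \<comment> \<open>Outer regularity is applied to a finite measure, so \<nu> is restricted to a
      ball around \<open>B\<close>. The open sets \<open>W \<inter> U\<close> that arise are bounded
      and fall under \<open>open_le\<close>.\<close>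
    define W where "W = ball (undefined::'a) r"
    have W: "open W" "bounded W" "B \<subseteq> W" "W \<in> sets borel" using r by (auto simp: W_def)
    have B_eq: "W \<inter> B = B" using W(3) by auto
    note e = emeasure_restr_meas[OF \<nu> W(4)]
    note l = locfinD[OF restr_meas_locfin[OF \<nu> W(4)]]
    have fin: "emeasure (restr_meas \<nu> W) (space (restr_meas \<nu> W)) \<noteq> \<infinity>"
      using locfinD(3)[OF \<nu> W(4,2)] l(2) by (simp add: e)
    have "emeasure \<mu> B \<le> emeasure (restr_meas \<nu> W) B"
      unfolding outer_regular[OF l(1) fin B(1)]
    proof (rule INF_greatest)
      fix U assume "U \<in> {U. B \<subseteq> U \<and> open U}"
      then have U: "B \<subseteq> U" "open U" by auto
      have "emeasure \<mu> B \<le> emeasure \<mu> (W \<inter> U)"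
        using U W \<mu> by (intro emeasure_mono) (auto simp: locfinD)
      also have "\<dots> \<le> emeasure \<nu> (W \<inter> U)"
        using U W by (intro open_le) (auto simp: bounded_Int)
      finally show "emeasure \<mu> B \<le> emeasure (restr_meas \<nu> W) U"
        using U by (simp add: e)
    qed
    then show ?thesis using B by (simp add: e B_eq)
  qed
  then show ?thesis by (simp add: meas_le_def)
qed

lemma evals_measurable: "evals \<in> borel_measurable RM_space"
  unfolding evals_def measure_def
  by (intro measurable_coordinatewise_then_product borel_measurable_enn2real
      emeasure_RM_measurable borel bdd)

text \<open>The masses of ring members determine the measurable structure: a Dynkin argument is run
  on the traces \<open>B \<inter> R i\<close>, whose masses are finite so that complements can be
  subtracted, and \<open>cover\<close> then reaches every bounded Borel set.\<close>

lemma sets_RM_space_evals: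
  assumes "U \<in> sets RM_space"
  obtains V where "V \<in> sets borel" "U = evals -` V \<inter> locfin_measures"
proof -
  define N where "N = vimage_algebra locfin_measures evals borel"
  have spN: "space N = locfin_measures" by (simp add: N_def)
  have ev: "evals \<in> borel_measurable N"
    unfolding N_def by (rule measurable_vimage_algebra1) auto
  have R_m: "(\<lambda>\<mu>. emeasure \<mu> (R k)) \<in> borel_measurable N" for k
  proof -
    have "(\<lambda>\<mu>. ennreal (evals \<mu> k)) \<in> borel_measurable N"
      by (intro measurable_compose[OF measurable_compose[OF ev] measurable_ennreal]
          borel_measurable_continuous_onI continuous_on_product_coordinates)
    then show ?thesis
      by (subst measurable_cong[where g="\<lambda>\<mu>. ennreal (evals \<mu> k)"]) (auto simp: spN emeasure_R)
  qed
  have m: "(\<lambda>\<mu>. emeasure \<mu> (B \<inter> R i)) \<in> borel_measurable N" if "B \<in> sets borel" for B i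
  proof -
    have st: "Int_stable (range R)" by (rule Int_stableI) (rule rs.Int)
    have B: "B \<in> sigma_sets UNIV (range R)" using that by (simp add: sigma_sets_R)
    show ?thesis
      using st rs.space_closed B
    proof (induction rule: sigma_sets_induct_disjoint)
      case (basic A)
      then have "A \<inter> R i \<in> range R" by (intro rs.Int) auto
      then obtain k where k: "A \<inter> R i = R k" by auto
      then show ?case using R_m[of k] by simp
    next
      case empty then show ?case by simp
    next
      case (compl A)
      then have A: "A \<in> sets borel" by (simp add: sigma_sets_R)
      have "emeasure \<mu> ((UNIV - A) \<inter> R i) = emeasure \<mu> (UNIV \<inter> R i) - emeasure \<mu> (A \<inter> R i)"
        if \<mu>: "\<mu> \<in> locfin_measures" for \<mu>
      proof -
        have "emeasure \<mu> (A \<inter> R i) \<noteq> \<infinity>"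
          using locfinD(3)[OF \<mu>, of "A \<inter> R i"] A borel bdd by (auto simp: bounded_Int)
        moreover have "(UNIV - A) \<inter> R i = R i - A \<inter> R i" by auto
        ultimately show ?thesis
          using A borel \<mu> by (simp add: emeasure_Diff locfinD(1))
      qed
      moreover have "(\<lambda>\<mu>. emeasure \<mu> (UNIV \<inter> R i)) \<in> borel_measurable N" using R_m[of i] by simp
      ultimately show ?case
        using compl.IH
        by (subst measurable_cong[where g="\<lambda>\<mu>. emeasure \<mu> (UNIV \<inter> R i) - emeasure \<mu> (A \<inter> R i)"])
           (auto simp: spN)
    next
      case (union A)
      then have A: "\<And>k. A k \<in> sets borel" by (auto simp: sigma_sets_R)
      have "emeasure \<mu> ((\<Union>k. A k) \<inter> R i) = (\<Sum>k. emeasure \<mu> (A k \<inter> R i))"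
        if "\<mu> \<in> locfin_measures" for \<mu>
      proof -
        have "disjoint_family (\<lambda>k. A k \<inter> R i)"
          using union.hyps(1) by (fastforce simp: disjoint_family_on_def)
        then show ?thesis
          using A borel that by (subst suminf_emeasure) (auto simp: locfinD(1))
      qed
      with union.IH show ?case
        by (subst measurable_cong[where g="\<lambda>\<mu>. \<Sum>k. emeasure \<mu> (A k \<inter> R i)"])
           (auto simp: spN)
    qed
  qed
  have "sets RM_space \<subseteq> sets N"
    unfolding RM_space_def
  proof (subst sets_measure_of)
    show "sigma_sets locfin_measures {{\<mu> \<in> locfin_measures. emeasure \<mu> B \<le> t} |B t. B \<in> sets borel \<and> bounded B} \<subseteq> sets N"
      unfolding spN[symmetric]
    proof (rule sets.sigma_sets_subset, safe)
      fix B :: "'a set" and t assume B: "B \<in> sets borel" "bounded B"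
      obtain i where "B \<subseteq> R i" using cover[OF B(2)] by blast
      then have "B \<inter> R i = B" by auto
      with m[OF B(1), of i] have "(\<lambda>\<mu>. emeasure \<mu> B) \<in> borel_measurable N" by simp
      then show "{\<mu> \<in> space N. emeasure \<mu> B \<le> t} \<in> sets N" by simp
    qed
  qed auto
  with assms have "U \<in> sets N" by blast
  with that show ?thesis by (auto simp: N_def sets_vimage_algebra2)
qed

text \<open>Approximation from inside by compact ring elements yields continuity at the empty set, by the
  finite intersection property, and hence countable additivity.\<close>

lemma locfin_measure_extension:
  assumes nonneg: "\<And>i. 0 \<le> y i"
    and add: "\<And>i j k. R i \<inter> R j = {} \<Longrightarrow> R k = R i \<union> R j \<Longrightarrow> y k = y i + y j"
    and inner: "\<And>i e. 0 < e \<Longrightarrow> \<exists>j k. compact (R j) \<and> R j \<subseteq> R i \<and> R k = R i - R j \<and> y k \<le> e"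
  obtains \<mu> where "\<mu> \<in> locfin_measures" "evals \<mu> = y"
proof -
  obtain i0 where i0: "R i0 = {}" using rs.empty_sets by (metis rangeE)
  \<comment> \<open>The empty set is the disjoint union of two copies of itself, which gives the
    value 0. Adding the empty set to a ring member then shows that \<open>y\<close> depends on the
    set and not on its index, so the set function \<open>f\<close> below is well defined.\<close>
  have y0: "y i0 = 0" using add[of i0 i0 i0] by (simp add: i0)
  have cong: "y i = y j" if "R i = R j" for i j
  proof -
    have "y j = y i + y i0" by (rule add) (use that i0 in auto)
    then show ?thesis by (simp add: y0)
  qed
  define f where "f E = y (SOME i. R i = E)" for E
  have f: "f (R i) = y i" for i
    unfolding f_def by (rule cong) (rule someI[of "\<lambda>j. R j = R i" i], simp)
  have f_add: "f (A \<union> B) = f A + f B" if AB: "A \<in> range R" "B \<in> range R" "A \<inter> B = {}" for A B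
  proof -
    obtain i j where ij: "A = R i" "B = R j" using AB by auto
    obtain k where k: "A \<union> B = R k" using rs.Un[OF AB(1,2)] by auto
    have "y k = y i + y j" by (rule add) (use AB ij k in auto)
    then show ?thesis by (simp only: k) (simp add: ij f)
  qed
  have f_nn: "0 \<le> f A" if "A \<in> range R" for A using that nonneg by (auto simp: f)
  have f_mono: "f A \<le> f B" if "A \<in> range R" "B \<in> range R" "A \<subseteq> B" for A B
  proof -
    have "f (A \<union> (B - A)) = f A + f (B - A)"
      using that by (intro f_add) auto
    moreover have "A \<union> (B - A) = B" using that by auto
    ultimately show ?thesis using f_nn[of "B - A"] that by auto
  qed
  have f_Un: "f (A \<union> B) \<le> f A + f B" if "A \<in> range R" "B \<in> range R" for A B
  proof -
    have "f (A \<union> (B - A)) = f A + f (B - A)"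
      using that by (intro f_add) auto
    moreover have "f (B - A) \<le> f B" using that by (intro f_mono) auto
    ultimately show ?thesis by (simp)
  qed
  have f_inner: "\<exists>K\<in>range R. compact K \<and> K \<subseteq> A \<and> f (A - K) \<le> e"
    if A: "A \<in> range R" and "0 < e" for A e
  proof -
    obtain i where i: "A = R i" using A by auto
    from inner[OF \<open>0 < e\<close>, of i] obtain j k where
      "compact (R j)" "R j \<subseteq> R i" "R k = R i - R j" "y k \<le> e" by blast
    then show ?thesis using f[of k] i by (intro bexI[of _ "R j"]) auto
  qed
  have cont: "(\<lambda>n. ennreal (f (A n))) \<longlonglongrightarrow> 0"
    if A: "range A \<subseteq> range R" and dec: "decseq A" and inter: "(\<Inter>n. A n) = {}" for A
  proof -
    have AR: "A n \<in> range R" for n using A by blast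
    have fdec: "decseq (\<lambda>n. f (A n))"
      using dec AR by (auto simp: decseq_def intro!: f_mono)
    have "\<exists>n. f (A n) < d" if "0 < d" for d
    proof (rule ccontr)
      assume "\<nexists>n. f (A n) < d"
      then have big: "d \<le> f (A n)" for n by (auto simp: not_less)
      \<comment> \<open>The losses d/4, d/8, ... up to index n add up to d/2 - d/2^(n+2). The
        intersection \<open>H n\<close> therefore misses less than d/2 of a set of value at least
        \<open>d\<close>, and cannot be empty.\<close>
      have "\<forall>n. \<exists>K. K \<in> range R \<and> compact K \<and> K \<subseteq> A n \<and> f (A n - K) \<le> d / 2 ^ (n + 2)"
        using f_inner[OF AR] \<open>0 < d\<close> by (auto simp: Bex_def)
      from choice[OF this] obtain K where K: "\<And>n. K n \<in> range R" "\<And>n. compact (K n)"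
        "\<And>n. K n \<subseteq> A n" "\<And>n. f (A n - K n) \<le> d / 2 ^ (n + 2)" by blast
      define H where "H n = (\<Inter>i\<le>n. K i)" for n
      have HR: "H n \<in> range R" for n
        unfolding H_def using K(1) by (intro rs.finite_INT) auto
      have bound: "f (A n - H n) \<le> d / 2 - d / 2 ^ (n + 2)" for n
      proof (induction n)
        case 0 then show ?case using K(4)[of 0] by (simp add: H_def)
      next
        case (Suc n)
        have "A (Suc n) - H (Suc n) \<subseteq> (A n - H n) \<union> (A (Suc n) - K (Suc n))"
          using dec by (auto simp: H_def atMost_Suc decseq_Suc_iff)
        then have "f (A (Suc n) - H (Suc n)) \<le> f ((A n - H n) \<union> (A (Suc n) - K (Suc n)))"
          using AR HR K(1) by (intro f_mono rs.Un rs.Diff)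
        also have "\<dots> \<le> f (A n - H n) + f (A (Suc n) - K (Suc n))"
          using AR HR K(1) by (intro f_Un rs.Diff)
        also have "\<dots> \<le> d / 2 - d / 2 ^ (Suc n + 2)"
          using Suc.IH K(4)[of "Suc n"] by (simp add: field_simps)
        finally show ?case .
      qed
      have Hne: "H n \<noteq> {}" for n
      proof
        assume "H n = {}"
        then have "f (A n) \<le> d / 2 - d / 2 ^ (n + 2)" using bound[of n] by simp
        moreover have "0 < d / 2 ^ (n + 2)" using \<open>0 < d\<close> by simp
        ultimately show False using big[of n] \<open>0 < d\<close> by linarith
      qed
      have "K 0 \<inter> \<Inter>(range K) \<noteq> {}"
      proof (rule compact_imp_fip[OF K(2)[of 0]])
        show "closed T" if "T \<in> range K" for T using that K(2) by (metis imageE compact_imp_closed)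
        show "K 0 \<inter> \<Inter>F' \<noteq> {}" if F': "finite F'" "F' \<subseteq> range K" for F'
        proof -
          obtain I where I: "finite I" "F' = K ` I" using finite_subset_image[OF F'] by blast
          obtain n where n: "\<forall>i\<in>I. i \<le> n" using I(1) unfolding finite_nat_set_iff_bounded_le ..
          have "H n \<subseteq> K 0 \<inter> \<Inter>F'" using n unfolding I(2) H_def by auto
          then show ?thesis using Hne[of n] by blast
        qed
      qed
      then obtain x where "\<And>n. x \<in> K n" by auto
      then have "x \<in> (\<Inter>n. A n)" using K(3) by (intro INT_I) (rule subsetD)
      then show False unfolding inter by simp
    qed
    then have small: "\<exists>n. f (A n) < d" if "0 < d" for d using that by blast
    have "(\<lambda>n. f (A n)) \<longlonglongrightarrow> 0"
    proof (rule LIMSEQ_I)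
      fix d :: real assume "0 < d"
      then obtain n where n: "f (A n) < d" using small by blast
      have "norm (f (A m) - 0) < d" if "n \<le> m" for m
        using decseqD[OF fdec that] n f_nn[OF AR[of m]] by simp
      then show "\<exists>n. \<forall>m\<ge>n. norm (f (A m) - 0) < d" by blast
    qed
    then show ?thesis using tendsto_ennrealI[of _ 0] by simp
  qed
  have "\<exists>m. (\<forall>s\<in>range R. m s = ennreal (f s)) \<and> measure_space UNIV (sigma_sets UNIV (range R)) m"
  proof (rule rs.caratheodory_empty_continuous)
    show "positive (range R) (\<lambda>s. ennreal (f s))"
      using f[of i0] by (simp add: positive_def i0 y0)
    show "additive (range R) (\<lambda>s. ennreal (f s))"
      using f_add f_nn by (simp add: additive_def ennreal_plus)
  qed (use cont in auto)
  then obtain m where m: "\<And>i. m (R i) = ennreal (f (R i))" "measure_space UNIV (sets borel) m"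
    unfolding sigma_sets_R by blast
  define \<mu> where "\<mu> = measure_of UNIV (sets borel) m"
  have s: "sets \<mu> = sets borel"
    unfolding \<mu>_def using sets.sigma_sets_eq[of "borel :: 'a measure"] by simp
  have e: "emeasure \<mu> E = m E" if "E \<in> sets borel" for E
    using m(2) that unfolding \<mu>_def measure_space_def
    by (intro emeasure_measure_of_sigma) auto
  have "\<mu> \<in> locfin_measures"
    unfolding locfin_measures_def
  proof (safe intro!: s)
    fix B :: "'a set" assume B: "B \<in> sets borel" "bounded B"
    obtain i where "B \<subseteq> R i" using cover[OF B(2)] by blast
    then have "emeasure \<mu> B \<le> emeasure \<mu> (R i)"
      using borel s by (intro emeasure_mono) auto
    also have "\<dots> < \<infinity>" by (simp add: e[OF borel] m(1))
    finally show "emeasure \<mu> B < \<infinity>" .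
  qed
  moreover have "evals \<mu> = y"
    by (auto simp: evals_def measure_def e[OF borel] m(1) f nonneg)
  ultimately show ?thesis by (rule that)
qed

end

text \<open>Starting from a countable base, close repeatedly under unions, differences and adjunction of the
  compact exhaustion of every set obtained so far.\<close>

lemma ex_borel_ring:
  fixes X :: "'b \<Rightarrow> ('a::polish_space) measure"
  assumes X: "random_measure \<Omega> X"
  obtains R where "borel_ring R"
    and "\<And>i. \<exists>C. compact_exhaustion \<Omega> X (R i) C \<and> range C \<subseteq> range R"
proof -
  have "\<forall>E. \<exists>C. E \<in> sets borel \<longrightarrow> bounded E \<longrightarrow> compact_exhaustion \<Omega> X E C"
    using ex_compact_exhaustion[OF X] by metis
  from choice[OF this] obtain c where c: "\<And>E. E \<in> sets borel \<Longrightarrow> bounded E \<Longrightarrow> compact_exhaustion \<Omega> X E (c E)"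
    by blast
  obtain B :: "'a set set" where B: "countable B" "topological_basis B"
    using ex_countable_basis by blast
  \<comment> \<open>Cutting by balls keeps every member bounded; inserting \<open>UNIV\<close> puts
    the balls themselves into the ring, which yields \<open>cover\<close>.\<close>
  define S0 where "S0 = (\<lambda>(b, n). b \<inter> ball undefined (real n)) ` (insert UNIV B \<times> (UNIV :: nat set))"
  define step where "step A = A \<union> (\<lambda>(a, b). a \<union> b) ` (A \<times> A) \<union> (\<lambda>(a, b). a - b) ` (A \<times> A)
      \<union> (\<lambda>(a, j). c a j) ` (A \<times> UNIV)" for A :: "'a set set"
  define S where "S n = (step ^^ n) S0" for n
  define T where "T = (\<Union>n. S n)"
  have SS: "S (Suc n) = step (S n)" for n by (simp add: S_def)
  have mono: "S n \<subseteq> S m" if "n \<le> m" for n m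
    using that by (rule lift_Suc_mono_le[rotated]) (auto simp: SS step_def)
  have "countable (S n)" for n
  proof (induction n)
    case 0 then show ?case using B(1) by (simp add: S_def S0_def)
  next
    case (Suc n) then show ?case unfolding SS step_def by (intro countable_Un countable_image countable_SIGMA) auto
  qed
  then have cT: "countable T" by (simp add: T_def)
  have S_good: "E \<in> sets borel \<and> bounded E" if "E \<in> S n" for E n
    using that
  proof (induction n arbitrary: E)
    case 0
    then show ?case
      using topological_basis_open[OF B(2)] by (auto simp: S_def S0_def bounded_Int)
  next
    case (Suc n)
    have "c a j \<in> sets borel \<and> bounded (c a j)" if "a \<in> S n" for a j
      using c[of a] Suc.IH[OF that] unfolding compact_exhaustion_def
      by (meson borel_compact compact_imp_bounded)
    with Suc show ?case
      unfolding SS step_def by (auto intro: bounded_subset)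
  qed
  have T_good: "E \<in> sets borel" "bounded E" if "E \<in> T" for E
    using that S_good by (auto simp: T_def)
  have Un_Diff: "a \<union> b \<in> T" "a - b \<in> T" if "a \<in> T" "b \<in> T" for a b
  proof -
    from that obtain n m where "a \<in> S n" "b \<in> S m" by (auto simp: T_def)
    then have "a \<in> S (max n m)" "b \<in> S (max n m)"
      using mono[of n "max n m"] mono[of m "max n m"] by auto
    then have "a \<union> b \<in> S (Suc (max n m))" "a - b \<in> S (Suc (max n m))"
      unfolding SS step_def by auto
    then show "a \<union> b \<in> T" "a - b \<in> T" by (auto simp: T_def)
  qed
  have cT2: "c a j \<in> T" if "a \<in> T" for a j
  proof -
    from that obtain n where "a \<in> S n" by (auto simp: T_def)
    then have "c a j \<in> S (Suc n)" unfolding SS step_def by auto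
    then show ?thesis by (auto simp: T_def)
  qed
  have S0T: "b \<inter> ball undefined (real n) \<in> T" if "b \<in> insert UNIV B" for b n
  proof -
    have "b \<inter> ball undefined (real n) \<in> S 0" using that by (auto simp: S_def S0_def)
    then show ?thesis unfolding T_def by blast
  qed
  have Tne: "T \<noteq> {}" using S0T by blast
  define R where "R = from_nat_into T"
  have ranR: "range R = T" unfolding R_def by (rule range_from_nat_into[OF Tne cT])
  have RT: "R i \<in> T" for i using ranR by auto
  have bnd: "\<exists>n. A \<subseteq> ball undefined (real n)" if A: "bounded A" for A :: "'a set"
  proof -
    obtain r where "A \<subseteq> ball undefined r" using bounded_subset_ballD[OF A] by blast
    moreover obtain n where "r \<le> real n" using real_arch_simple by blast
    ultimately show ?thesis using subset_ball by blast
  qed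
  have "borel_ring R"
  proof (rule borel_ring.intro)
    have "{} \<in> T" using Un_Diff(2) Tne by (metis Diff_cancel ex_in_conv)
    then show "ring_of_sets UNIV (range R)"
      using Un_Diff unfolding ranR ring_of_sets_iff by simp
    show "R i \<in> sets borel" "bounded (R i)" for i using T_good[OF RT] by auto
    show "\<exists>I. G = (\<Union>i\<in>I. R i)" if G: "open G" "bounded G" for G
    proof (intro exI[of _ "{i. R i \<subseteq> G}"] equalityI subsetI)
      fix x assume x: "x \<in> G"
      obtain n where n: "G \<subseteq> ball undefined (real n)" using bnd[OF G(2)] by blast
      obtain b where b: "b \<in> B" "x \<in> b" "b \<subseteq> G" using topological_basisE[OF B(2) G(1) x] by blast
      have "b \<inter> ball undefined (real n) \<in> range R" unfolding ranR using b by (intro S0T) auto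
      then obtain i where "R i = b \<inter> ball undefined (real n)" by force
      with b n x show "x \<in> (\<Union>i\<in>{i. R i \<subseteq> G}. R i)" by blast
    qed auto
    show "\<exists>i. A \<subseteq> R i" if A: "bounded A" for A
    proof -
      obtain n where n: "A \<subseteq> ball undefined (real n)" using bnd[OF A] by blast
      have "ball undefined (real n) \<in> range R" unfolding ranR using S0T[of UNIV n] by simp
      then show ?thesis using n by (metis imageE)
    qed
  qed
  moreover have "\<exists>C. compact_exhaustion \<Omega> X (R i) C \<and> range C \<subseteq> range R" for i
    using c[OF T_good[OF RT]] cT2[OF RT] unfolding ranR
    by (intro exI[of _ "c (R i)"]) auto
  ultimately show ?thesis by (rule that)
qed

subsection \<open>Upper sets and monotone cylinder functions\<close>

text \<open>Monotonicity in the coordinates below \<open>m\<close> also makes \<open>h\<close>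
  independent of the others: sequences that agree below \<open>m\<close> compare in both directions.
  Continuity refers to the product topology.\<close>

definition mono_cylinder :: "nat \<Rightarrow> ((nat \<Rightarrow> real) \<Rightarrow> real) \<Rightarrow> bool" where
  "mono_cylinder m h \<longleftrightarrow> continuous_on UNIV h \<and> (\<forall>z. 0 \<le> h z \<and> h z \<le> 1) \<and>
     (\<forall>z z'. (\<forall>i<m. z i \<le> z' i) \<longrightarrow> h z \<le> h z')"

lemma mono_cylinderD:
  assumes "mono_cylinder m h"
  shows "continuous_on UNIV h" "0 \<le> h z" "h z \<le> 1" "h \<in> borel_measurable borel"
    "(\<And>i. i < m \<Longrightarrow> z i \<le> z' i) \<Longrightarrow> h z \<le> h z'"
    "(\<And>i. i < m \<Longrightarrow> z i = z' i) \<Longrightarrow> h z = h z'"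
  using assms unfolding mono_cylinder_def
  by (auto intro!: borel_measurable_continuous_onI antisym)

lemma compact_upward_closure_approx:
  fixes K :: "(nat \<Rightarrow> real) set"
  assumes K: "compact K"
  obtains h where "\<And>m. mono_cylinder m (h m)"
    "\<And>z. (\<lambda>m. h m z) \<longlonglongrightarrow> indicator {z. \<exists>y\<in>K. \<forall>i. y i \<le> z i} z"
proof (cases "K = {}")
  case True
  then show ?thesis by (intro that[of "\<lambda>_ _. 0"]) (auto simp: mono_cylinder_def)
next
  case False
  \<comment> \<open>\<open>s\<close> is the total excess of \<open>y\<close> over \<open>z\<close>
    in the first \<open>m\<close> coordinates and \<open>d\<close> the least excess over
    \<open>K\<close>. The slope \<open>m\<close> of the cutoff grows with the number of coordinates,
    so \<open>h m z\<close> is nonzero only if some point of \<open>K\<close> exceeds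
    \<open>z\<close> by a total of less than 1/m.\<close>
  define s where "s m y z = (\<Sum>i<m. max 0 (y i - z i))" for m :: nat and y z :: "nat \<Rightarrow> real"
  define d where "d m z = (INF y\<in>K. s m y z)" for m z
  define h where "h m z = max 0 (1 - real m * d m z)" for m z
    \<comment> \<open>By compactness of K, if h m z does not tend to 0 then some y in K lies below z.\<close>
  have co: "continuous_on A (\<lambda>y::nat \<Rightarrow> real. y i)" for A i
    by (rule continuous_on_subset[OF continuous_on_product_coordinates]) simp
  have s_nn: "0 \<le> s m y z" for m y z by (auto simp: s_def intro: sum_nonneg)
  have bdd: "bdd_below ((\<lambda>y. s m y z) ` K)" for m z using s_nn by (intro bdd_belowI2)
  have d_le: "d m z \<le> s m y z" if "y \<in> K" for m y z
    unfolding d_def by (rule cINF_lower[OF bdd that])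
  have d_att: "\<exists>y\<in>K. d m z = s m y z" for m z
  proof -
    have "continuous_on K (\<lambda>y. s m y z)" unfolding s_def by (intro continuous_intros co)
    then obtain y where y: "y \<in> K" "\<And>y'. y' \<in> K \<Longrightarrow> s m y z \<le> s m y' z"
      using continuous_attains_inf[OF K False] by blast
    then have "d m z = s m y z"
      unfolding d_def by (intro cInf_eq_minimum) auto
    with y show ?thesis by blast
  qed
  have d_nn: "0 \<le> d m z" for m z using d_att[of m z] s_nn by auto
  have d_mono: "d m z' \<le> d m z" if "\<And>i. i < m \<Longrightarrow> z i \<le> z' i" for m z z'
  proof -
    obtain y where y: "y \<in> K" "d m z = s m y z" using d_att by blast
    have "s m y z' \<le> s m y z" unfolding s_def using that by (intro sum_mono) force
    with d_le[OF y(1), of m z'] y(2) show ?thesis by simp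
  qed
  \<comment> \<open>Moving \<open>z\<close> changes the least excess by at most the l1 distance over
    the first \<open>m\<close> coordinates, and this finite sum is continuous in the product
    topology.\<close>
  have d_lip: "d m z \<le> d m z' + (\<Sum>i<m. \<bar>z i - z' i\<bar>)" for m z z'
  proof -
    obtain y where y: "y \<in> K" "d m z' = s m y z'" using d_att by blast
    have "s m y z \<le> s m y z' + (\<Sum>i<m. \<bar>z i - z' i\<bar>)"
      unfolding s_def sum.distrib[symmetric] by (intro sum_mono) auto
    with d_le[OF y(1), of m z] y(2) show ?thesis by simp
  qed
  have d_cont: "continuous_on UNIV (d m)" for m
    unfolding continuous_on_def
  proof
    fix z :: "nat \<Rightarrow> real"
    have "((\<lambda>z'. \<Sum>i<m. \<bar>z' i - z i\<bar>) \<longlongrightarrow> (\<Sum>i<m. \<bar>z i - z i\<bar>)) (at z)"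
      using co[of UNIV] unfolding continuous_on_def by (intro tendsto_intros) auto
    then have "((\<lambda>z'. \<Sum>i<m. \<bar>z' i - z i\<bar>) \<longlongrightarrow> 0) (at z)" by simp
    then have "((\<lambda>z'. d m z' - d m z) \<longlongrightarrow> 0) (at z)"
    proof (rule Lim_null_comparison[rotated], intro always_eventually allI)
      fix z'
      have "(\<Sum>i<m. \<bar>z i - z' i\<bar>) = (\<Sum>i<m. \<bar>z' i - z i\<bar>)"
        by (simp add: abs_minus_commute)
      then show "norm (d m z' - d m z) \<le> (\<Sum>i<m. \<bar>z' i - z i\<bar>)"
        using d_lip[of m z z'] d_lip[of m z' z] by (simp add: abs_le_iff)
    qed
    then show "(d m \<longlongrightarrow> d m z) (at z)" by (rule LIM_zero_cancel)
  qed
  show ?thesis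
  proof
    show "mono_cylinder m (h m)" for m
      unfolding mono_cylinder_def h_def
      using d_nn[of m] mult_nonneg_nonneg[OF of_nat_0_le_iff d_nn] d_mono d_cont
      by (intro conjI allI impI continuous_intros max.mono diff_left_mono mult_left_mono) (auto intro: continuous_on_mult)
    fix z :: "nat \<Rightarrow> real"
    show "(\<lambda>m. h m z) \<longlonglongrightarrow> indicator {z. \<exists>y\<in>K. \<forall>i. y i \<le> z i} z"
    proof (cases "\<exists>y\<in>K. \<forall>i. y i \<le> z i")
      case True
      then obtain y where y: "y \<in> K" "\<And>i. y i \<le> z i" by blast
      have "d m z = 0" for m
      proof -
        have "s m y z = 0" using y(2) by (simp add: s_def max_absorb1)
        then show ?thesis using d_le[OF y(1), of m z] d_nn[of m z] by simp
      qed
      then show ?thesis using True by (simp add: h_def)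
    next
      case False
      have "\<exists>N. \<forall>m\<ge>N. h m z = 0"
      proof (rule ccontr)
        assume "\<nexists>N. \<forall>m\<ge>N. h m z = 0"
        then have inf: "\<forall>N. \<exists>m. N \<le> m \<and> h m z \<noteq> 0" by blast
        from choice[OF this] obtain r where r: "\<And>N. N \<le> r N" "\<And>N. h (r N) z \<noteq> 0" by blast
        have "\<forall>N. \<exists>y. y \<in> K \<and> d (r N) z = s (r N) y z" using d_att by blast
        from choice[OF this] obtain y where y: "\<And>N. y N \<in> K" "\<And>N. d (r N) z = s (r N) (y N) z"
          by blast
        obtain l u where l: "l \<in> K" "strict_mono u" "(y \<circ> u) \<longlonglongrightarrow> l"
          using K y(1) unfolding compact_eq_seq_compact_metric seq_compact_def by metis
        \<comment> \<open>A nonzero \<open>h (r N) z\<close> bounds the total excess by 1 / r N,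
          hence by 1 / N since \<open>N \<le> r N\<close>; coordinate \<open>i\<close> takes part in
          that sum once \<open>i < N\<close>.\<close>
        have bound: "y N i - z i \<le> 1 / real N" if "i < N" for N i
        proof -
          have "y N i - z i \<le> s (r N) (y N) z"
            unfolding s_def using that r(1)[of N]
            by (intro order_trans[OF _ member_le_sum[of i]]) auto
          moreover have "real (r N) * s (r N) (y N) z < 1"
            using r(2)[of N] y(2)[of N] by (auto simp: h_def max_def split: if_splits)
          moreover have "real N * s (r N) (y N) z \<le> real (r N) * s (r N) (y N) z"
            using r(1)[of N] s_nn by (intro mult_right_mono) auto
          moreover have "real N * (y N i - z i) \<le> real N * s (r N) (y N) z"
            using calculation(1) by (intro mult_left_mono) auto
          ultimately have "real N * (y N i - z i) \<le> 1" by linarith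
          then show ?thesis using that by (simp add: field_simps)
        qed
        have "l i \<le> z i" for i
        proof -
          have "(\<lambda>n. (y \<circ> u) n i) \<longlonglongrightarrow> l i"
            by (rule continuous_on_tendsto_compose[OF co[of UNIV i] l(3)]) auto
          then have "(\<lambda>n. y (u n) i - z i) \<longlonglongrightarrow> l i - z i"
            by (intro tendsto_intros) (simp add: o_def)
          moreover have "(\<lambda>n. 1 / real (u n)) \<longlonglongrightarrow> 0"
            using LIMSEQ_subseq_LIMSEQ[OF lim_1_over_n l(2)] by (simp add: o_def)
          moreover have "\<forall>\<^sub>F n in sequentially. y (u n) i - z i \<le> 1 / real (u n)"
            using eventually_gt_at_top[of i]
          proof eventually_elim
            case (elim n)
            then show ?case using seq_suble[OF l(2), of n] by (intro bound) simp
          qed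
          ultimately have "l i - z i \<le> 0"
            by (intro tendsto_le[OF trivial_limit_sequentially])
          then show ?thesis by simp
        qed
        with l(1) False show False by blast
      qed
      then have "\<forall>\<^sub>F m in sequentially. h m z = 0" unfolding eventually_sequentially .
      then have "(\<lambda>m. h m z) \<longlonglongrightarrow> 0" by (rule tendsto_eventually)
      then show ?thesis using False by simp
    qed
  qed
qed

section \<open>Mean approximation by monotone cylinder functions\<close>

context borel_ring
begin

text \<open>The coordinate sequences in I below form a Borel set that carries the law of evals (X) and, by the
  extension lemma, lies in the range of evals. This makes inner regularity on the Polish space of real
  sequences available without knowing that the vague topology is Polish.\<close>

lemma compact_inner_approx:
  fixes X :: "'b \<Rightarrow> 'a measure"
  assumes X: "random_measure \<Omega> X"
    and inner: "\<And>i. \<exists>C. compact_exhaustion \<Omega> X (R i) C \<and> range C \<subseteq> range R"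
    and U: "U \<in> sets RM_space" and e: "0 < e"
  obtains K where "compact K" "K \<subseteq> evals ` U"
    "measure \<Omega> {\<omega> \<in> space \<Omega>. X \<omega> \<in> U} < measure \<Omega> {\<omega> \<in> space \<Omega>. evals (X \<omega>) \<in> K} + e"
proof -
  note XD = random_measureD[OF X]
  interpret prob_space \<Omega> by (rule XD(1))
  from choice[OF allI[OF inner]] obtain C where
    "\<forall>i. compact_exhaustion \<Omega> X (R i) (C i) \<and> range (C i) \<subseteq> range R" ..
  then have C: "\<And>i j. compact (C i j)" "\<And>i j. C i j \<subseteq> R i" "\<And>i j. C i j \<in> range R"
    "\<And>i. AE \<omega> in \<Omega>. (\<lambda>j. measure (X \<omega>) (R i - C i j)) \<longlonglongrightarrow> 0"
    by (simp_all add: compact_exhaustion_def image_subset_iff)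
  define c where "c i j = (SOME k. R k = C i j)" for i j
  have c: "R (c i j) = C i j" for i j
    unfolding c_def using C(3)[of i j] by (intro someI_ex[of "\<lambda>k. R k = C i j"]) auto
  define d where "d i j = (SOME k. R k = R i - C i j)" for i j
  have d: "R (d i j) = R i - C i j" for i j
    unfolding d_def using rs.Diff[OF rangeI[of R i] C(3)[of i j]]
    by (intro someI_ex[of "\<lambda>k. R k = R i - C i j"]) (auto simp: image_iff)
  \<comment> \<open>The three blocks encode the hypotheses of
    \<open>locfin_measure_extension\<close>. Taking the inner approximants from the fixed
    exhaustions and the tolerances from 1/(n+1) leaves countable intersections and unions of closed
    conditions, so \<open>I\<close> is Borel.\<close>
  define I where "I = (\<Inter>i. {y :: nat \<Rightarrow> real. 0 \<le> y i}) \<inter>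
     (\<Inter>i. \<Inter>j. \<Inter>k. {y. R i \<inter> R j = {} \<and> R k = R i \<union> R j \<longrightarrow> y k = y i + y j}) \<inter>
     (\<Inter>i. \<Inter>n. \<Union>j. {y. y (d i j) \<le> 1 / real (Suc n)})"
  have co: "continuous_on UNIV (\<lambda>y::nat \<Rightarrow> real. y i)" for i
    by (rule continuous_on_product_coordinates)
  have "{y :: nat \<Rightarrow> real. 0 \<le> y i} \<in> sets borel" for i
    by (intro borel_closed closed_Collect_le co continuous_on_const)
  moreover have "{y :: nat \<Rightarrow> real. P \<longrightarrow> y k = y i + y j} \<in> sets borel" for i j k P
    by (intro borel_closed closed_Collect_imp open_Collect_const closed_Collect_eq continuous_on_add co)
  moreover have "{y :: nat \<Rightarrow> real. y i \<le> c} \<in> sets borel" for i c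
    by (intro borel_closed closed_Collect_le co continuous_on_const)
  ultimately have Is: "I \<in> sets borel"
    unfolding I_def by (intro sets.Int sets.countable_INT'' sets.countable_UN) auto
  have I_img: "\<exists>\<mu>. \<mu> \<in> locfin_measures \<and> evals \<mu> = y" if y: "y \<in> I" for y
  proof -
    obtain \<mu> where "\<mu> \<in> locfin_measures" "evals \<mu> = y"
    proof (rule locfin_measure_extension[of y])
      fix i and e :: real assume "0 < e"
      then obtain n where n: "1 / Suc n < e" using nat_approx_posE by blast
      have "\<exists>j. y (d i j) \<le> 1 / real (Suc n)" using y unfolding I_def by auto
      then obtain j where "y (d i j) \<le> 1 / Suc n" by blast
      then show "\<exists>j k. compact (R j) \<and> R j \<subseteq> R i \<and> R k = R i - R j \<and> y k \<le> e"
        using C(1,2) n by (intro exI[of _ "c i j"] exI[of _ "d i j"]) (auto simp: c d)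
    qed (use y in \<open>auto simp: I_def\<close>)
    then show ?thesis by blast
  qed
  have X_I: "AE \<omega> in \<Omega>. evals (X \<omega>) \<in> I"
  proof -
    have "AE \<omega> in \<Omega>. \<forall>i. (\<lambda>j. measure (X \<omega>) (R i - C i j)) \<longlonglongrightarrow> 0"
      using C(4) by (simp add: AE_all_countable)
    then show ?thesis
      using AE_space
    proof eventually_elim
      case (elim \<omega>)
      note l = XD(3)[OF elim(2)]
      have "evals (X \<omega>) k = evals (X \<omega>) i + evals (X \<omega>) j"
        if "R i \<inter> R j = {}" "R k = R i \<union> R j" for i j k
        unfolding evals_def that(2)
        using that(1) locfinD(3)[OF l borel bdd, of i] locfinD(3)[OF l borel bdd, of j] borel locfinD(1)[OF l]
        by (intro measure_Union) auto
      moreover have "\<exists>j. evals (X \<omega>) (d i j) \<le> 1 / Suc n" for i n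
      proof -
        have "\<forall>\<^sub>F j in sequentially. evals (X \<omega>) (d i j) < 1 / Suc n"
          using order_tendstoD(2)[OF elim(1)[rule_format, of i], of "1 / Suc n"]
          by (simp add: evals_def d)
        then show ?thesis
          using eventually_happens'[OF sequentially_bot] less_imp_le by blast
      qed
      ultimately show ?case by (auto simp: I_def evals_def)
    qed
  qed
  obtain V where V: "V \<in> sets borel" "U = evals -` V \<inter> locfin_measures"
    using sets_RM_space_evals[OF U] by blast
  have ev[measurable]: "(\<lambda>\<omega>. evals (X \<omega>)) \<in> borel_measurable \<Omega>"
    by (rule measurable_compose[OF XD(2) evals_measurable])
  define D where "D = distr \<Omega> borel (\<lambda>\<omega>. evals (X \<omega>))"
  have sD: "sets D = sets borel" by (simp add: D_def)
  interpret D: prob_space D unfolding D_def by (rule prob_space_distr[OF ev])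
  have VI: "V \<inter> I \<in> sets borel" using V(1) Is by auto
  have "\<exists>K\<in>{K. K \<subseteq> V \<inter> I \<and> compact K}. emeasure D (V \<inter> I) < emeasure D K + ennreal e"
    using e by (intro SUP_approx_ennreal[OF _ _ inner_regular[OF sD _ VI]]) auto
  then obtain K where K: "K \<subseteq> V \<inter> I" "compact K" "emeasure D (V \<inter> I) < emeasure D K + ennreal e"
    by blast
  have KB: "K \<in> sets borel" using K(2) by (rule borel_compact)
  \<comment> \<open>Intersecting with \<open>I\<close> costs no mass, since almost every realisation
    has its coordinates in \<open>I\<close>.\<close>
  have "measure \<Omega> {\<omega> \<in> space \<Omega>. X \<omega> \<in> U} = measure D (V \<inter> I)"
  proof -
    have "measure D (V \<inter> I) = measure \<Omega> ((\<lambda>\<omega>. evals (X \<omega>)) -` (V \<inter> I) \<inter> space \<Omega>)"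
      unfolding D_def using VI by (rule measure_distr[OF ev])
    also have "\<dots> = measure \<Omega> {\<omega> \<in> space \<Omega>. X \<omega> \<in> U}"
    proof (rule finite_measure_eq_AE)
      show "AE \<omega> in \<Omega>. (\<omega> \<in> (\<lambda>\<omega>. evals (X \<omega>)) -` (V \<inter> I) \<inter> space \<Omega>) =
          (\<omega> \<in> {\<omega> \<in> space \<Omega>. X \<omega> \<in> U})"
        using X_I AE_space by eventually_elim (auto simp: V(2) XD(3))
      show "{\<omega> \<in> space \<Omega>. X \<omega> \<in> U} \<in> sets \<Omega>"
        using measurable_sets[OF XD(2) U] by (simp add: vimage_def Int_def conj_commute)
      show "(\<lambda>\<omega>. evals (X \<omega>)) -` (V \<inter> I) \<inter> space \<Omega> \<in> sets \<Omega>"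
        by (rule measurable_sets[OF ev VI])
    qed
    finally show ?thesis ..
  qed
  also have "\<dots> < measure D K + e"
    using K(3) e by (simp add: D.emeasure_eq_measure ennreal_plus[symmetric] ennreal_less_iff del: ennreal_plus)
  also have "measure D K = measure \<Omega> {\<omega> \<in> space \<Omega>. evals (X \<omega>) \<in> K}"
    unfolding D_def using KB by (subst measure_distr[OF ev]) (auto intro: arg_cong[where f="measure \<Omega>"])
  finally show ?thesis
  proof (rule that[OF K(2), rotated])
    \<comment> \<open>Points of \<open>K\<close> come from measures because \<open>K\<close> lies in
      \<open>I\<close>; these measures belong to \<open>U\<close> because \<open>U\<close> is the
      full preimage of \<open>V\<close> among the locally finite measures.\<close>
    show "K \<subseteq> evals ` U" using K(1) I_img unfolding V(2) by blast
  qed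
qed

text \<open>The upward closure of a compact K in evals ` U pulls back into U, since U is an upper set.\<close>

lemma upper_set_approx:
  fixes X :: "'b \<Rightarrow> 'a measure"
  assumes X: "random_measure \<Omega> X"
    and inner: "\<And>i. \<exists>C. compact_exhaustion \<Omega> X (R i) C \<and> range C \<subseteq> range R"
    and U: "U \<in> sets RM_space" and e: "0 < e"
    and up: "\<And>\<mu> \<nu>. \<mu> \<in> U \<Longrightarrow> \<nu> \<in> locfin_measures \<Longrightarrow> meas_le \<mu> \<nu> \<Longrightarrow> \<nu> \<in> U"
  obtains m h where "mono_cylinder m h"
    "(\<integral>\<omega>. \<bar>indicator U (X \<omega>) - h (evals (X \<omega>))\<bar> \<partial>\<Omega>) \<le> e"
proof -
  note XD = random_measureD[OF X]
  interpret prob_space \<Omega> by (rule XD(1))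
  have ev[measurable]: "(\<lambda>\<omega>. evals (X \<omega>)) \<in> borel_measurable \<Omega>"
    by (rule measurable_compose[OF XD(2) evals_measurable])
  have [measurable]: "X \<in> measurable \<Omega> RM_space" by (rule XD(2))
  note U[measurable]
  obtain K where K: "compact K" "K \<subseteq> evals ` U"
    "measure \<Omega> {\<omega> \<in> space \<Omega>. X \<omega> \<in> U} < measure \<Omega> {\<omega> \<in> space \<Omega>. evals (X \<omega>) \<in> K} + e / 2"
    using compact_inner_approx[OF X inner U, of "e / 2"] e by auto
  have [measurable]: "K \<in> sets borel" using K(1) by (rule borel_compact)
  define J where "J = {z. \<exists>y\<in>K. \<forall>i. y i \<le> z i}"
  obtain h where h: "\<And>m. mono_cylinder m (h m)" "\<And>z. (\<lambda>m. h m z) \<longlonglongrightarrow> indicator J z"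
    by (rule compact_upward_closure_approx[OF K(1), folded J_def]) (rule that)
  note hD = mono_cylinderD[OF h(1)]
  note hD(4)[measurable]
  \<comment> \<open>Measurability is inherited from the continuous functions \<open>h m\<close>,
    whose pointwise limit is the indicator of \<open>J\<close>.\<close>
  have J[measurable]: "(\<lambda>\<omega>. indicator J (evals (X \<omega>)) :: real) \<in> borel_measurable \<Omega>"
    by (rule borel_measurable_LIMSEQ_real[where u="\<lambda>m \<omega>. h m (evals (X \<omega>))"]) (auto intro: h(2))
  have U'[measurable]: "(\<lambda>\<omega>. indicator U (X \<omega>) :: real) \<in> borel_measurable \<Omega>"
    by measurable
  have int: "integrable \<Omega> f" if "f \<in> borel_measurable \<Omega>" "\<And>\<omega>. \<omega> \<in> space \<Omega> \<Longrightarrow> \<bar>f \<omega>\<bar> \<le> 1" for f :: "'b \<Rightarrow> real"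
    using that by (intro integrable_const_bound[where B=1]) auto
  have JU: "evals (X \<omega>) \<in> J \<Longrightarrow> X \<omega> \<in> U" if \<omega>: "\<omega> \<in> space \<Omega>" for \<omega>
  proof -
    assume "evals (X \<omega>) \<in> J"
    then obtain \<mu> where \<mu>: "\<mu> \<in> U" "\<And>i. evals \<mu> i \<le> evals (X \<omega>) i" using K(2) unfolding J_def by blast
    have "\<mu> \<in> locfin_measures" using \<mu>(1) sets.sets_into_space[OF U] by (auto simp: space_RM_space)
    then show ?thesis using \<mu> XD(3)[OF \<omega>] by (intro up[OF \<mu>(1)] evals_le_imp_meas_le)
  qed
  have KJ: "K \<subseteq> J" by (auto simp: J_def)
  \<comment> \<open>The event for \<open>J\<close> lies between those for \<open>K\<close> and for
    \<open>U\<close>, so replacing \<open>U\<close> by \<open>J\<close> costs no more than replacing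
    it by \<open>K\<close>.\<close>
  have "(\<integral>\<omega>. \<bar>indicator U (X \<omega>) - indicator J (evals (X \<omega>)) :: real\<bar> \<partial>\<Omega>)
      \<le> (\<integral>\<omega>. indicator {\<omega> \<in> space \<Omega>. X \<omega> \<in> U} \<omega> - indicator {\<omega> \<in> space \<Omega>. evals (X \<omega>) \<in> K} \<omega> \<partial>\<Omega>)"
    using JU KJ by (intro integral_mono int) (auto split: split_indicator)
  also have "\<dots> = measure \<Omega> {\<omega> \<in> space \<Omega>. X \<omega> \<in> U} - measure \<Omega> {\<omega> \<in> space \<Omega>. evals (X \<omega>) \<in> K}"
    by (subst Bochner_Integration.integral_diff) (auto intro!: int simp: Int_absorb2)
  also have "\<dots> \<le> e / 2" using K(3) by simp
  finally have 1: "(\<integral>\<omega>. \<bar>indicator U (X \<omega>) - indicator J (evals (X \<omega>)) :: real\<bar> \<partial>\<Omega>) \<le> e / 2" .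
  have "(\<lambda>m. \<integral>\<omega>. \<bar>indicator J (evals (X \<omega>)) - h m (evals (X \<omega>))\<bar> \<partial>\<Omega>) \<longlonglongrightarrow> (\<integral>\<omega>. 0 \<partial>\<Omega>)"
  proof (rule integral_dominated_convergence[where w="\<lambda>_. 1"])
    show "AE \<omega> in \<Omega>. (\<lambda>m. \<bar>indicator J (evals (X \<omega>)) - h m (evals (X \<omega>))\<bar>) \<longlonglongrightarrow> 0"
    proof (intro AE_I2)
      fix \<omega>
      have "(\<lambda>m. \<bar>indicator J (evals (X \<omega>)) - h m (evals (X \<omega>))\<bar>) \<longlonglongrightarrow>
          \<bar>indicator J (evals (X \<omega>)) - indicator J (evals (X \<omega>))\<bar>"
        by (intro tendsto_intros h(2))
      then show "(\<lambda>m. \<bar>indicator J (evals (X \<omega>)) - h m (evals (X \<omega>))\<bar>) \<longlonglongrightarrow> 0" by simp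
    qed
    show "AE \<omega> in \<Omega>. norm \<bar>indicator J (evals (X \<omega>)) - h m (evals (X \<omega>))\<bar> \<le> 1" for m
      using hD(2,3)[of m] by (intro AE_I2) (auto split: split_indicator)
  qed auto
  then have "\<forall>\<^sub>F m in sequentially. (\<integral>\<omega>. \<bar>indicator J (evals (X \<omega>)) - h m (evals (X \<omega>))\<bar> \<partial>\<Omega>) < e / 2"
    using e by (intro order_tendstoD(2)) auto
  then obtain m where 2: "(\<integral>\<omega>. \<bar>indicator J (evals (X \<omega>)) - h m (evals (X \<omega>))\<bar> \<partial>\<Omega>) < e / 2"
    using eventually_happens'[OF sequentially_bot] by blast
  have "(\<integral>\<omega>. \<bar>indicator U (X \<omega>) - h m (evals (X \<omega>))\<bar> \<partial>\<Omega>)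
     \<le> (\<integral>\<omega>. \<bar>indicator U (X \<omega>) - indicator J (evals (X \<omega>))\<bar> + \<bar>indicator J (evals (X \<omega>)) - h m (evals (X \<omega>))\<bar> \<partial>\<Omega>)"
    using hD(2,3)[of m]
    by (intro integral_mono Bochner_Integration.integrable_add int) (auto split: split_indicator)
  also have "\<dots> = (\<integral>\<omega>. \<bar>indicator U (X \<omega>) - indicator J (evals (X \<omega>)) :: real\<bar> \<partial>\<Omega>)
     + (\<integral>\<omega>. \<bar>indicator J (evals (X \<omega>)) - h m (evals (X \<omega>))\<bar> \<partial>\<Omega>)"
    using hD(2,3)[of m] by (intro Bochner_Integration.integral_add int) (auto split: split_indicator)
  finally have "(\<integral>\<omega>. \<bar>indicator U (X \<omega>) - h m (evals (X \<omega>))\<bar> \<partial>\<Omega>) \<le> e"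
    using 1 2 by simp
  then show ?thesis by (rule that[OF h(1)])
qed

lemma mono_functional_approx:
  fixes X :: "'b \<Rightarrow> 'a measure"
  assumes X: "random_measure \<Omega> X"
    and inner: "\<And>i. \<exists>C. compact_exhaustion \<Omega> X (R i) C \<and> range C \<subseteq> range R"
    and f: "bdd_mono_functional f" and f01: "\<And>\<mu>. \<mu> \<in> locfin_measures \<Longrightarrow> 0 \<le> f \<mu> \<and> f \<mu> \<le> 1"
    and e: "0 < e"
  obtains m h where "mono_cylinder m h"
    "(\<integral>\<omega>. \<bar>f (X \<omega>) - h (evals (X \<omega>))\<bar> \<partial>\<Omega>) \<le> e"
proof -
  note XD = random_measureD[OF X]
  interpret prob_space \<Omega> by (rule XD(1))
  have [measurable]: "X \<in> measurable \<Omega> RM_space" by (rule XD(2))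
  have ev[measurable]: "(\<lambda>\<omega>. evals (X \<omega>)) \<in> borel_measurable \<Omega>"
    by (rule measurable_compose[OF XD(2) evals_measurable])
  have fm[measurable]: "f \<in> borel_measurable RM_space" using f by (simp add: bdd_mono_functional_def)
  \<comment> \<open>Half of \<open>e\<close> is spent on the discretisation error 1/N, the other
    half on approximating the level sets.\<close>
  obtain N :: nat where N_gt: "2 / e < real N" using reals_Archimedean2 by blast
  have "0 < 2 / e" using e by simp
  with N_gt have "0 < real N" by linarith
  then have N: "0 < N" "1 / real N \<le> e / 2"
    using N_gt e by (auto simp: field_simps)
  \<comment> \<open>f is within 1/N of the average of the indicators of its upper level sets at k/N.\<close>
  define U where "U k = {\<mu> \<in> locfin_measures. real k \<le> real N * f \<mu>}" for k
  have U_sets: "U k \<in> sets RM_space" for k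
  proof -
    have "{\<mu> \<in> space RM_space. real k \<le> real N * f \<mu>} \<in> sets RM_space" by measurable
    then show ?thesis by (simp add: U_def space_RM_space)
  qed
  have "\<forall>k. \<exists>mh. mono_cylinder (fst mh) (snd mh) \<and>
     (\<integral>\<omega>. \<bar>indicator (U k) (X \<omega>) - snd mh (evals (X \<omega>))\<bar> \<partial>\<Omega>) \<le> e / 2"
  proof
    fix k
    have up: "\<nu> \<in> U k" if "\<mu> \<in> U k" "\<nu> \<in> locfin_measures" "meas_le \<mu> \<nu>" for \<mu> \<nu>
    proof -
      have "f \<mu> \<le> f \<nu>" using f that by (auto simp: bdd_mono_functional_def U_def)
      then have "real N * f \<mu> \<le> real N * f \<nu>" by (simp add: mult_left_mono)
      then show ?thesis using that by (auto simp: U_def)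
    qed
    obtain m h where "mono_cylinder m h"
      "(\<integral>\<omega>. \<bar>indicator (U k) (X \<omega>) - h (evals (X \<omega>))\<bar> \<partial>\<Omega>) \<le> e / 2"
    proof (rule upper_set_approx[OF X inner U_sets[of k] half_gt_zero[OF e]])
      fix \<mu> \<nu> assume "\<mu> \<in> U k" "\<nu> \<in> locfin_measures" "meas_le \<mu> \<nu>"
      then show "\<nu> \<in> U k" by (rule up)
    qed (rule that)
    then show "\<exists>mh. mono_cylinder (fst mh) (snd mh) \<and>
     (\<integral>\<omega>. \<bar>indicator (U k) (X \<omega>) - snd mh (evals (X \<omega>))\<bar> \<partial>\<Omega>) \<le> e / 2"
      by (intro exI[of _ "(m, h)"]) auto
  qed
  from choice[OF this] obtain mh where mh: "\<And>k. mono_cylinder (fst (mh k)) (snd (mh k))"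
     "\<And>k. (\<integral>\<omega>. \<bar>indicator (U k) (X \<omega>) - snd (mh k) (evals (X \<omega>))\<bar> \<partial>\<Omega>) \<le> e / 2" by blast
  define h where "h k = snd (mh k)" for k
  \<comment> \<open>The sum is a crude common bound for the numbers of coordinates read by the
    functions \<open>h k\<close> with k from 1 to N.\<close>
  define M where "M = (\<Sum>k=1..N. fst (mh k))"
  note hD = mono_cylinderD[OF mh(1), folded h_def]
  note hD(4)[measurable]
  \<comment> \<open>The sum starts at k = 1 because level 0 is always reached; among the levels 1 to
    N exactly floor(N * f) are.\<close>
  define H where "H z = (\<Sum>k=1..N. h k z) / real N" for z
  have H01: "0 \<le> H z" "H z \<le> 1" for z
  proof -
    show "0 \<le> H z" unfolding H_def by (intro divide_nonneg_nonneg sum_nonneg hD) auto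
    have "(\<Sum>k=1..N. h k z) \<le> (\<Sum>k=1..N. 1)" by (intro sum_mono hD)
    then show "H z \<le> 1" using N(1) by (simp add: H_def)
  qed
  have H: "mono_cylinder M H"
    unfolding mono_cylinder_def
  proof (intro conjI allI impI H01)
    show "continuous_on UNIV H"
      unfolding H_def using hD(1) N(1) by (intro continuous_intros) auto
    fix z z' :: "nat \<Rightarrow> real" assume le: "\<forall>i<M. z i \<le> z' i"
    have "h k z \<le> h k z'" if "k \<in> {1..N}" for k
    proof (rule hD(5))
      have "fst (mh k) \<le> M" unfolding M_def using that by (intro member_le_sum) auto
      then show "z i \<le> z' i" if "i < fst (mh k)" for i using le that by auto
    qed
    then show "H z \<le> H z'" unfolding H_def by (intro divide_right_mono sum_mono) auto
  qed
  have int: "integrable \<Omega> f" if "f \<in> borel_measurable \<Omega>" "\<And>\<omega>. \<omega> \<in> space \<Omega> \<Longrightarrow> \<bar>f \<omega>\<bar> \<le> 1" for f :: "'b \<Rightarrow> real"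
    using that by (intro integrable_const_bound[where B=1]) auto
  note U_sets[measurable]
  have int': "integrable \<Omega> (\<lambda>\<omega>. \<bar>indicator (U k) (X \<omega>) - h k (evals (X \<omega>))\<bar>)" for k
    using hD(2,3)[of k] by (intro int) (auto split: split_indicator)
  have pt: "\<bar>f (X \<omega>) - H (evals (X \<omega>))\<bar> \<le> e / 2 + (\<Sum>k=1..N. \<bar>indicator (U k) (X \<omega>) - h k (evals (X \<omega>))\<bar>) / real N"
    if \<omega>: "\<omega> \<in> space \<Omega>" for \<omega>
  proof -
    define x where "x = f (X \<omega>)"
    have x: "0 \<le> x" "x \<le> 1" using f01[OF XD(3)[OF \<omega>]] by (auto simp: x_def)
    define n where "n = nat \<lfloor>real N * x\<rfloor>"
    have n: "real n \<le> real N * x" "real N * x < real n + 1"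
      using x unfolding n_def by (auto simp: of_nat_nat)
    have "n \<le> N"
    proof -
      have "real n \<le> real N * 1" using n(1) x(2) mult_left_mono[of x 1 "real N"] by simp
      then show ?thesis by simp
    qed
    have k: "X \<omega> \<in> U k \<longleftrightarrow> k \<le> n" for k
    proof -
      have "X \<omega> \<in> U k \<longleftrightarrow> real k \<le> real N * x" using XD(3)[OF \<omega>] by (simp add: U_def x_def)
      also have "\<dots> \<longleftrightarrow> k \<le> n" using n by linarith
      finally show ?thesis .
    qed
    have "(\<Sum>k=1..N. indicator (U k) (X \<omega>) :: real) = (\<Sum>k=1..n. 1)"
      using \<open>n \<le> N\<close> by (intro sum.mono_neutral_cong_right) (auto simp: k indicator_def)
    then have s: "(\<Sum>k=1..N. indicator (U k) (X \<omega>) :: real) = real n" by simp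
    have "\<bar>x - real n / real N\<bar> \<le> 1 / real N"
    proof -
      have "x - real n / real N = (real N * x - real n) / real N" using N(1) by (simp add: field_simps)
      moreover have "\<bar>real N * x - real n\<bar> \<le> 1" using n by linarith
      ultimately show ?thesis by (simp add: divide_right_mono)
    qed
    moreover have "\<bar>real n / real N - H (evals (X \<omega>))\<bar>
       \<le> (\<Sum>k=1..N. \<bar>indicator (U k) (X \<omega>) - h k (evals (X \<omega>))\<bar>) / real N"
      unfolding s[symmetric] H_def diff_divide_distrib[symmetric] sum_subtractf[symmetric] abs_divide
      by (auto intro: divide_right_mono sum_abs)
    ultimately show ?thesis using N(2) unfolding x_def by linarith
  qed
  have "(\<integral>\<omega>. \<bar>f (X \<omega>) - H (evals (X \<omega>))\<bar> \<partial>\<Omega>)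
     \<le> (\<integral>\<omega>. e / 2 + (\<Sum>k=1..N. \<bar>indicator (U k) (X \<omega>) - h k (evals (X \<omega>))\<bar>) / real N \<partial>\<Omega>)"
  proof (rule integral_mono[OF _ _ pt])
    have "\<bar>f (X \<omega>) - H (evals (X \<omega>))\<bar> \<le> 1" if "\<omega> \<in> space \<Omega>" for \<omega>
      using f01[OF XD(3)[OF that]] H01[of "evals (X \<omega>)"] by linarith
    then show "integrable \<Omega> (\<lambda>\<omega>. \<bar>f (X \<omega>) - H (evals (X \<omega>))\<bar>)"
      using mono_cylinderD(4)[OF H] by (intro int) auto
    show "integrable \<Omega> (\<lambda>\<omega>. e / 2 + (\<Sum>k=1..N. \<bar>indicator (U k) (X \<omega>) - h k (evals (X \<omega>))\<bar>) / real N)"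
      using int' by (intro Bochner_Integration.integrable_add integrable_divide_zero Bochner_Integration.integrable_sum) auto
  qed
  also have "\<dots> = e / 2 + (\<Sum>k=1..N. (\<integral>\<omega>. \<bar>indicator (U k) (X \<omega>) - h k (evals (X \<omega>))\<bar> \<partial>\<Omega>)) / real N"
    using int' by (subst Bochner_Integration.integral_add) (auto simp: prob_space)
  also have "\<dots> \<le> e / 2 + (\<Sum>k=1..N. e / 2) / real N"
    using mh(2)[folded h_def] by (intro add_left_mono divide_right_mono sum_mono) auto
  also have "\<dots> = e" using N(1) by simp
  finally show ?thesis by (rule that[OF H])
qed

end

subsection \<open>Approximation by vaguely continuous functionals\<close>

definition bump :: "'a::metric_space set \<Rightarrow> nat \<Rightarrow> 'a \<Rightarrow> real" where
  \<comment> \<open>The case distinction is needed because infdist to the empty set is 0.\<close>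
  "bump C k x = (if C = {} then 0 else max 0 (1 - real (Suc k) * infdist x C))"

lemma bump_bounds: "0 \<le> bump C k x" "bump C k x \<le> 1"
  using infdist_nonneg[of x C] by (auto simp: bump_def)

lemma bump_antimono: "k \<le> l \<Longrightarrow> bump C l x \<le> bump C k x"
  unfolding bump_def using infdist_nonneg[of x C]
  by (auto intro!: max.mono mult_right_mono simp del: max.bounded_iff)

lemma bump_nonzeroD:
  assumes "bump C k x \<noteq> 0"
  obtains p where "p \<in> C" "dist x p < 1 / real (Suc k)"
proof -
  have C: "C \<noteq> {}" and "real (Suc k) * infdist x C < 1"
    using assms by (auto simp: bump_def max_def split: if_splits)
  then have "(INF p\<in>C. dist x p) < 1 / real (Suc k)"
    by (simp add: infdist_notempty[symmetric] field_simps)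
  then obtain p where "p \<in> C" "dist x p < 1 / real (Suc k)"
    using C by (subst (asm) cINF_less_iff) (auto intro: bdd_belowI2[of _ 0])
  then show ?thesis by (rule that)
qed

lemma vague_test_fun_bump:
  fixes C :: "'a::polish_space set"
  assumes "bounded C"
  shows "vague_test_fun (bump C k)"
  unfolding vague_test_fun_def
proof (intro conjI allI bump_bounds)
  show "continuous_on UNIV (bump C k)"
  proof (cases "C = {}")
    case False
    then have "bump C k = (\<lambda>x. max 0 (1 - real (Suc k) * infdist x C))" by (simp add: bump_def fun_eq_iff)
    then show ?thesis by (simp only:) (intro continuous_intros)
  qed (simp add: bump_def[abs_def])
  show "bounded (range (bump C k))"
    using bump_bounds[of C k] by (intro boundedI[of _ 1]) (auto simp: abs_le_iff intro: order_trans[of _ 0])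
  obtain r where r: "C \<subseteq> ball undefined r" using bounded_subset_ballD[OF assms] by blast
  have "{x. bump C k x \<noteq> 0} \<subseteq> ball undefined (r + 1)"
  proof
    fix x assume "x \<in> {x. bump C k x \<noteq> 0}"
    then obtain p where p: "p \<in> C" "dist x p < 1 / real (Suc k)" by (auto elim: bump_nonzeroD)
    have "1 / real (Suc k) \<le> 1" by simp
    then have "dist x p < 1" using p(2) by linarith
    moreover have "dist undefined p < r" using r p(1) by auto
    ultimately show "x \<in> ball undefined (r + 1)"
      using dist_triangle[of undefined x p] by (simp add: dist_commute)
  qed
  then show "bounded {x. bump C k x \<noteq> 0}" by (rule bounded_subset[rotated]) simp
qed

lemma bump_tendsto_indicator:
  assumes "closed C"
  shows "(\<lambda>k. bump C k x) \<longlonglongrightarrow> indicator C x"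
proof (cases "C = {}")
  case C: False
  show ?thesis
  proof (cases "x \<in> C")
    case True
    then show ?thesis by (simp add: bump_def C)
  next
    case False
    then have "0 < infdist x C"
      using assms C in_closed_iff_infdist_zero[of C x] infdist_nonneg[of x C] by (simp add: order_less_le)
    then obtain k where k: "1 / real (Suc k) < infdist x C" using nat_approx_posE by blast
    have "bump C l x = 0" if "k \<le> l" for l
    proof -
      have "bump C k x = 0" using k by (auto simp: bump_def field_simps max_def)
      then show ?thesis using bump_antimono[OF that, of C x] bump_bounds(1)[of C l x] by simp
    qed
    then have "\<forall>\<^sub>F l in sequentially. bump C l x = 0" unfolding eventually_sequentially by blast
    then show ?thesis using False by (simp add: tendsto_eventually)
  qed
qed (simp add: bump_def)

lemma bump_integral_tendsto:
  fixes C :: "'a::polish_space set"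
  assumes \<mu>: "\<mu> \<in> locfin_measures" and C: "compact C"
  shows "(\<lambda>k. \<integral>x. bump C k x \<partial>\<mu>) \<longlonglongrightarrow> measure \<mu> C"
proof -
  note v = vague_test_fun_bump[OF compact_imp_bounded[OF C]]
  have CB: "C \<in> sets \<mu>" using borel_compact[OF C] locfinD(1)[OF \<mu>] by simp
  \<comment> \<open>The bumps decrease in \<open>k\<close>, so the widest of them, integrable
    because its support is bounded, dominates the others.\<close>
  have "(\<lambda>k. \<integral>x. bump C k x \<partial>\<mu>) \<longlonglongrightarrow> (\<integral>x. indicator C x \<partial>\<mu>)"
  proof (rule integral_dominated_convergence[where w="bump C 0"])
    show "integrable \<mu> (bump C 0)" by (rule vague_test_fun_integral(1)[OF v \<mu>])
    show "bump C k \<in> borel_measurable \<mu>" for k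
      using vague_test_fun_integral(1)[OF v \<mu>] by auto
    show "AE x in \<mu>. (\<lambda>k. bump C k x) \<longlonglongrightarrow> indicator C x"
      by (intro AE_I2 bump_tendsto_indicator compact_imp_closed C)
    show "AE x in \<mu>. norm (bump C k x) \<le> bump C 0 x" for k
      by (intro AE_I2) (simp add: bump_bounds bump_antimono)
  qed (use CB in auto)
  then show ?thesis using CB locfinD(2)[OF \<mu>] by simp
qed

lemma compact_closed_separation:
  fixes P Q :: "'a::metric_space set"
  assumes P: "compact P" and Q: "closed Q" and disj: "P \<inter> Q = {}"
  obtains d where "0 < d" "\<And>x y. x \<in> P \<Longrightarrow> y \<in> Q \<Longrightarrow> d \<le> dist x y"
proof (cases "P = {} \<or> Q = {}")
  case True
  then show ?thesis by (intro that[of 1]) auto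
next
  case False
  have "continuous_on P (\<lambda>x. infdist x Q)" by (intro continuous_intros)
  then obtain p where p: "p \<in> P" "\<And>x. x \<in> P \<Longrightarrow> infdist p Q \<le> infdist x Q"
    using continuous_attains_inf[OF P] False by blast
  have "0 < infdist p Q"
    using p(1) disj Q False in_closed_iff_infdist_zero[of Q p] infdist_nonneg[of p Q] by (auto simp: order_less_le)
  moreover have "infdist p Q \<le> dist x y" if "x \<in> P" "y \<in> Q" for x y
    using p(2)[OF that(1)] infdist_le[OF that(2), of x] by linarith
  ultimately show ?thesis by (rule that)
qed

text \<open>All coordinates share one sharpness \<open>k\<close>. Closeness in mean and disjointness
  of supports can thus both be stated for all large \<open>k\<close> and be met
  simultaneously.\<close>

definition bump_functional :: "((nat \<Rightarrow> real) \<Rightarrow> real) \<Rightarrow> (nat \<Rightarrow> 'a::polish_space set) \<Rightarrow> nat \<Rightarrow> 'a measure \<Rightarrow> real" where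
  "bump_functional h C k \<mu> = h (\<lambda>i. \<integral>x. bump (C i) k x \<partial>\<mu>)"

lemma vague_continuous_integral:
  assumes "vague_test_fun f"
  shows "continuous_map vague_topology euclideanreal (\<lambda>\<mu>. \<integral>x. f x \<partial>\<mu>)"
proof -
  let ?S = "{{\<mu>. (\<integral>x. f x \<partial>\<mu>) \<in> U} | f U. vague_test_fun f \<and> open U} :: 'a measure set set"
  have "openin (topology_generated_by ?S) {\<mu> \<in> topspace (topology_generated_by ?S). (\<integral>x. f x \<partial>\<mu>) \<in> U}"
    if "open U" for U
  proof -
    have U: "{\<mu>. (\<integral>x. f x \<partial>\<mu>) \<in> U} \<in> ?S" using assms that by blast
    then have "{\<mu> \<in> topspace (topology_generated_by ?S). (\<integral>x. f x \<partial>\<mu>) \<in> U} = {\<mu>. (\<integral>x. f x \<partial>\<mu>) \<in> U}"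
      unfolding topology_generated_by_topspace by blast
    then show ?thesis using topology_generated_by_Basis[OF U] by simp
  qed
  then have "continuous_map (topology_generated_by ?S) euclideanreal (\<lambda>\<mu>. \<integral>x. f x \<partial>\<mu>)"
    by (simp add: continuous_map_def)
  then show ?thesis unfolding vague_topology_def by (rule continuous_map_from_subtopology)
qed

lemma bump_functional_vague_continuous:
  assumes h: "mono_cylinder m h" and C: "\<And>i. compact (C i)"
  shows "continuous_map vague_topology euclideanreal (bump_functional h C k)"
proof -
  have "continuous_map vague_topology (product_topology (\<lambda>_. euclideanreal) UNIV) (\<lambda>\<mu> i. \<integral>x. bump (C i) k x \<partial>\<mu>)"
    unfolding continuous_map_componentwise_UNIV
    by (intro allI vague_continuous_integral vague_test_fun_bump compact_imp_bounded C)
  then have "continuous_map vague_topology euclidean (\<lambda>\<mu> i. \<integral>x. bump (C i) k x \<partial>\<mu>)"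
    by (simp only: euclidean_product_topology)
  moreover have "continuous_map euclidean euclideanreal h"
    using mono_cylinderD(1)[OF h] by simp
  ultimately have "continuous_map vague_topology euclideanreal (h \<circ> (\<lambda>\<mu> i. \<integral>x. bump (C i) k x \<partial>\<mu>))"
    by (rule continuous_map_compose)
  then show ?thesis by (simp add: bump_functional_def[abs_def] o_def)
qed

lemma bump_functional_bdd_mono:
  assumes h: "mono_cylinder m h" and C: "\<And>i. compact (C i)"
  shows "bdd_mono_functional (bump_functional h C k)"
  unfolding bdd_mono_functional_def
proof (intro conjI exI[of _ 1] ballI impI)
  note v = vague_test_fun_bump[OF compact_imp_bounded[OF C]]
  show "bump_functional h C k \<in> borel_measurable RM_space"
    unfolding bump_functional_def
    by (rule measurable_compose[OF _ mono_cylinderD(4)[OF h]])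
      (intro measurable_coordinatewise_then_product vague_test_fun_measurable v)
  show "\<bar>bump_functional h C k \<mu>\<bar> \<le> 1" for \<mu>
    using mono_cylinderD(2,3)[OF h] by (simp add: bump_functional_def)
  show "bump_functional h C k \<mu> \<le> bump_functional h C k \<nu>"
    if "\<mu> \<in> locfin_measures" "\<nu> \<in> locfin_measures" "meas_le \<mu> \<nu>" for \<mu> \<nu>
    unfolding bump_functional_def
    by (intro mono_cylinderD(5)[OF h] vague_test_fun_mono v that)
qed

text \<open>Since \<open>h\<close> reads the coordinates below \<open>m\<close> only, a finite union
  of bump supports can serve as the set \<open>A\<close> here; such a union may stick out of the
  Borel set in which the compact sets were chosen.\<close>

lemma bump_functional_on:
  assumes h: "mono_cylinder m h" and C: "\<And>i. compact (C i)"
    and A: "A \<in> sets borel" "\<And>i. i < m \<Longrightarrow> {x. bump (C i) k x \<noteq> 0} \<subseteq> A"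
  shows "functional_on (bump_functional h C k) A"
  unfolding functional_on_def bump_functional_def
proof (intro ballI mono_cylinderD(6)[OF h])
  fix \<mu> :: "'a measure" and i assume "\<mu> \<in> locfin_measures" "i < m"
  then show "(\<integral>x. bump (C i) k x \<partial>\<mu>) = (\<integral>x. bump (C i) k x \<partial>restr_meas \<mu> A)"
    using A by (intro integral_restr_meas[symmetric] vague_test_fun_bump compact_imp_bounded C) auto
qed

section \<open>Estimates in mean and approximation within a Borel set\<close>

lemma tendsto_coordinatewise:
  fixes z :: "nat \<Rightarrow> 'a \<Rightarrow> 'b::topological_space"
  assumes "\<And>i. (\<lambda>n. z n i) \<longlonglongrightarrow> l i"
  shows "z \<longlonglongrightarrow> l"
proof -
  have "limitin (product_topology (\<lambda>_. euclidean) UNIV) z l sequentially"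
    unfolding limitin_componentwise using assms by simp
  then show ?thesis by (simp add: euclidean_product_topology)
qed

lemma (in prob_space) mono_cylinder_L1_tendsto:
  assumes h: "mono_cylinder m h"
    and Z: "\<And>n. Z n \<in> borel_measurable M" "Y \<in> borel_measurable M"
    and lim: "AE \<omega> in M. \<forall>i. (\<lambda>n. Z n \<omega> i) \<longlonglongrightarrow> Y \<omega> i"
  shows "(\<lambda>n. \<integral>\<omega>. \<bar>h (Y \<omega>) - h (Z n \<omega>)\<bar> \<partial>M) \<longlonglongrightarrow> 0"
proof -
  note hD = mono_cylinderD[OF h]
  note [measurable] = hD(4) Z
  have "(\<lambda>n. \<integral>\<omega>. \<bar>h (Y \<omega>) - h (Z n \<omega>)\<bar> \<partial>M) \<longlonglongrightarrow> (\<integral>\<omega>. 0 \<partial>M)"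
  proof (rule integral_dominated_convergence[where w="\<lambda>_. 1"])
    show "AE \<omega> in M. (\<lambda>n. \<bar>h (Y \<omega>) - h (Z n \<omega>)\<bar>) \<longlonglongrightarrow> 0"
      using lim
    proof eventually_elim
      case (elim \<omega>)
      have "(\<lambda>n. Z n \<omega>) \<longlonglongrightarrow> Y \<omega>" using elim by (intro tendsto_coordinatewise) auto
      then have "(\<lambda>n. h (Z n \<omega>)) \<longlonglongrightarrow> h (Y \<omega>)"
        by (rule continuous_on_tendsto_compose[OF hD(1)]) auto
      then have "(\<lambda>n. \<bar>h (Y \<omega>) - h (Z n \<omega>)\<bar>) \<longlonglongrightarrow> \<bar>h (Y \<omega>) - h (Y \<omega>)\<bar>"
        by (intro tendsto_intros)
      then show ?case by simp
    qed
    show "AE \<omega> in M. norm \<bar>h (Y \<omega>) - h (Z n \<omega>)\<bar> \<le> 1" for n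
    proof (intro AE_I2)
      fix \<omega> show "norm \<bar>h (Y \<omega>) - h (Z n \<omega>)\<bar> \<le> 1"
        using hD(2,3)[of "Y \<omega>"] hD(2,3)[of "Z n \<omega>"] by simp
    qed
  qed auto
  then show ?thesis by simp
qed

lemma (in prob_space) L1_dist_triangle:
  fixes f g h :: "'a \<Rightarrow> real"
  assumes "f \<in> borel_measurable M" "g \<in> borel_measurable M" "h \<in> borel_measurable M"
    and "\<And>\<omega>. \<omega> \<in> space M \<Longrightarrow> 0 \<le> f \<omega> \<and> f \<omega> \<le> 1" "\<And>\<omega>. \<omega> \<in> space M \<Longrightarrow> 0 \<le> g \<omega> \<and> g \<omega> \<le> 1"
    "\<And>\<omega>. \<omega> \<in> space M \<Longrightarrow> 0 \<le> h \<omega> \<and> h \<omega> \<le> 1"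
  shows "(\<integral>\<omega>. \<bar>f \<omega> - h \<omega>\<bar> \<partial>M) \<le> (\<integral>\<omega>. \<bar>f \<omega> - g \<omega>\<bar> \<partial>M) + (\<integral>\<omega>. \<bar>g \<omega> - h \<omega>\<bar> \<partial>M)"
proof -
  have int: "integrable M f" "integrable M g" "integrable M h"
    using assms by (auto intro!: integrable_const_bound[where B=1])
  then have "(\<integral>\<omega>. \<bar>f \<omega> - h \<omega>\<bar> \<partial>M) \<le> (\<integral>\<omega>. \<bar>f \<omega> - g \<omega>\<bar> + \<bar>g \<omega> - h \<omega>\<bar> \<partial>M)"
    by (intro integral_mono) auto
  also have "\<dots> = (\<integral>\<omega>. \<bar>f \<omega> - g \<omega>\<bar> \<partial>M) + (\<integral>\<omega>. \<bar>g \<omega> - h \<omega>\<bar> \<partial>M)"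
    using int by (intro Bochner_Integration.integral_add) auto
  finally show ?thesis .
qed

text \<open>Since \<open>f\<close> does not distinguish \<open>X\<close> from its restriction to
  \<open>A\<close>, the cylinder approximation is carried out for the restriction, whose coordinates
  are the masses of \<open>A \<inter> R i\<close>; this builds locality into the approximant. Three
  errors of size e/3 arise: from \<open>f\<close> to a function of these masses, from the masses to
  those of compact subsets, and from the latter to integrals of bumps.\<close>

lemma functional_on_bump_approx:
  fixes X :: "'b \<Rightarrow> ('a::polish_space) measure"
  assumes X: "random_measure \<Omega> X" and f: "bdd_mono_functional f"
    and f01: "\<And>\<mu>. \<mu> \<in> locfin_measures \<Longrightarrow> 0 \<le> f \<mu> \<and> f \<mu> \<le> 1"
    and A: "A \<in> sets borel" "functional_on f A" and e: "0 < e"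
  obtains m h C where "mono_cylinder m h" "\<And>i. compact (C i)" "\<And>i. C i \<subseteq> A"
    "\<forall>\<^sub>F k in sequentially. (\<integral>\<omega>. \<bar>f (X \<omega>) - bump_functional h C k (X \<omega>)\<bar> \<partial>\<Omega>) < e"
proof -
  note XD = random_measureD[OF X]
  interpret prob_space \<Omega> by (rule XD(1))
  define Y where "Y \<omega> = restr_meas (X \<omega>) A" for \<omega>
  have Y: "random_measure \<Omega> Y"
    unfolding random_measure_def Y_def
    using XD(1) measurable_compose[OF XD(2) restr_meas_measurable[OF A(1)]] by simp
  obtain R where R: "borel_ring R" "\<And>i. \<exists>C. compact_exhaustion \<Omega> Y (R i) C \<and> range C \<subseteq> range R"
    by (rule ex_borel_ring[OF Y]) (rule that)
  interpret borel_ring R by (rule R(1))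
  have fY: "f (Y \<omega>) = f (X \<omega>)" if "\<omega> \<in> space \<Omega>" for \<omega>
    using A(2) XD(3)[OF that] by (simp add: functional_on_def Y_def)
  have fm[measurable]: "f \<in> borel_measurable RM_space" using f by (simp add: bdd_mono_functional_def)
  have [measurable]: "X \<in> measurable \<Omega> RM_space" by (rule XD(2))
  obtain m h where h: "mono_cylinder m h" and fh: "(\<integral>\<omega>. \<bar>f (Y \<omega>) - h (evals (Y \<omega>))\<bar> \<partial>\<Omega>) \<le> e / 3"
    by (rule mono_functional_approx[OF Y R(2) f f01, of "e / 3"]) (use e in auto)
  note hD = mono_cylinderD[OF h]
  note hD(4)[measurable]
  have AR: "A \<inter> R i \<in> sets borel" "bounded (A \<inter> R i)" for i
    using A(1) borel bdd by (auto simp: bounded_Int)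
  \<comment> \<open>The sets \<open>A \<inter> R i\<close> need not belong to the ring, and their
    compact approximants must lie in \<open>A\<close>, so exhaustions are chosen afresh with respect
    to \<open>X\<close>.\<close>
  have "\<forall>i. \<exists>C. compact_exhaustion \<Omega> X (A \<inter> R i) C"
    using ex_compact_exhaustion[OF X AR] by blast
  from choice[OF this] obtain C where "\<forall>i. compact_exhaustion \<Omega> X (A \<inter> R i) (C i)" ..
  then have C: "\<And>i j. compact (C i j)" "\<And>i j. C i j \<subseteq> A \<inter> R i"
    "\<And>i. AE \<omega> in \<Omega>. (\<lambda>j. measure (X \<omega>) (A \<inter> R i - C i j)) \<longlonglongrightarrow> 0"
    by (simp_all add: compact_exhaustion_def)
  have CB: "C i j \<in> sets borel" "bounded (C i j)" for i j
    using C(1) borel_compact compact_imp_bounded by auto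
  define y where "y \<omega> i = measure (X \<omega>) (A \<inter> R i)" for \<omega> i
  define z where "z j \<omega> i = measure (X \<omega>) (C i j)" for j \<omega> i
  define w where "w j k \<omega> i = (\<integral>x. bump (C i j) k x \<partial>X \<omega>)" for j k \<omega> i
  have ym[measurable]: "y \<in> borel_measurable \<Omega>"
    unfolding y_def by (intro measurable_coordinatewise_then_product XD(5) AR)
  have zm[measurable]: "z j \<in> borel_measurable \<Omega>" for j
    unfolding z_def by (intro measurable_coordinatewise_then_product XD(5) CB)
  have wm[measurable]: "w j k \<in> borel_measurable \<Omega>" for j k
    unfolding w_def
    by (intro measurable_coordinatewise_then_product
        measurable_compose[OF XD(2) vague_test_fun_measurable[OF vague_test_fun_bump[OF CB(2)]]])
  have evals_Y: "evals (Y \<omega>) = y \<omega>" if "\<omega> \<in> space \<Omega>" for \<omega>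
    using emeasure_restr_meas[OF XD(3)[OF that] A(1) borel]
    by (simp add: fun_eq_iff evals_def y_def Y_def measure_def)
  have fy: "(\<integral>\<omega>. \<bar>f (X \<omega>) - h (y \<omega>)\<bar> \<partial>\<Omega>) \<le> e / 3"
    using fh by (simp add: evals_Y fY cong: Bochner_Integration.integral_cong)
  have "(\<lambda>j. \<integral>\<omega>. \<bar>h (y \<omega>) - h (z j \<omega>)\<bar> \<partial>\<Omega>) \<longlonglongrightarrow> 0"
  proof (rule mono_cylinder_L1_tendsto[OF h zm ym])
    have "AE \<omega> in \<Omega>. \<forall>i. (\<lambda>j. measure (X \<omega>) (A \<inter> R i - C i j)) \<longlonglongrightarrow> 0"
      using C(3) by (simp add: AE_all_countable)
    then show "AE \<omega> in \<Omega>. \<forall>i. (\<lambda>j. z j \<omega> i) \<longlonglongrightarrow> y \<omega> i"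
      using AE_space
    proof eventually_elim
      case (elim \<omega>)
      note l = locfinD[OF XD(3)[OF elim(2)]]
      have "z j \<omega> i = y \<omega> i - measure (X \<omega>) (A \<inter> R i - C i j)" for i j
        unfolding z_def y_def using l(3)[OF AR, of i] AR CB C(2) l(1)
        by (subst measure_Diff) auto
      moreover have "(\<lambda>j. y \<omega> i - measure (X \<omega>) (A \<inter> R i - C i j)) \<longlonglongrightarrow> y \<omega> i - 0" for i
        using elim(1) by (intro tendsto_intros) auto
      ultimately show ?case by simp
    qed
  qed
  then have "\<forall>\<^sub>F j in sequentially. (\<integral>\<omega>. \<bar>h (y \<omega>) - h (z j \<omega>)\<bar> \<partial>\<Omega>) < e / 3"
    using e by (intro order_tendstoD(2)) auto
  then obtain j where j: "(\<integral>\<omega>. \<bar>h (y \<omega>) - h (z j \<omega>)\<bar> \<partial>\<Omega>) < e / 3"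
    using eventually_happens'[OF sequentially_bot] by blast
  have "(\<lambda>k. \<integral>\<omega>. \<bar>h (z j \<omega>) - h (w j k \<omega>)\<bar> \<partial>\<Omega>) \<longlonglongrightarrow> 0"
  proof (rule mono_cylinder_L1_tendsto[OF h wm zm])
    show "AE \<omega> in \<Omega>. \<forall>i. (\<lambda>k. w j k \<omega> i) \<longlonglongrightarrow> z j \<omega> i"
      unfolding w_def z_def using XD(3) C(1) by (intro AE_I2 allI bump_integral_tendsto) auto
  qed
  then have "\<forall>\<^sub>F k in sequentially. (\<integral>\<omega>. \<bar>h (z j \<omega>) - h (w j k \<omega>)\<bar> \<partial>\<Omega>) < e / 3"
    using e by (intro order_tendstoD(2)) auto
  then have "\<forall>\<^sub>F k in sequentially. (\<integral>\<omega>. \<bar>f (X \<omega>) - bump_functional h (\<lambda>i. C i j) k (X \<omega>)\<bar> \<partial>\<Omega>) < e"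
  proof eventually_elim
    case (elim k)
    have "w j k \<omega> = (\<lambda>i. \<integral>x. bump (C i j) k x \<partial>X \<omega>)" for \<omega>
      by (simp add: w_def fun_eq_iff)
    then have "bump_functional h (\<lambda>i. C i j) k (X \<omega>) = h (w j k \<omega>)" for \<omega>
      by (simp add: bump_functional_def)
    moreover have "(\<integral>\<omega>. \<bar>f (X \<omega>) - h (w j k \<omega>)\<bar> \<partial>\<Omega>)
        \<le> (\<integral>\<omega>. \<bar>f (X \<omega>) - h (y \<omega>)\<bar> \<partial>\<Omega>) + (\<integral>\<omega>. \<bar>h (y \<omega>) - h (w j k \<omega>)\<bar> \<partial>\<Omega>)"
      using f01 XD(3) hD(2,3) by (intro L1_dist_triangle) auto
    moreover have "(\<integral>\<omega>. \<bar>h (y \<omega>) - h (w j k \<omega>)\<bar> \<partial>\<Omega>)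
        \<le> (\<integral>\<omega>. \<bar>h (y \<omega>) - h (z j \<omega>)\<bar> \<partial>\<Omega>) + (\<integral>\<omega>. \<bar>h (z j \<omega>) - h (w j k \<omega>)\<bar> \<partial>\<Omega>)"
      using hD(2,3) by (intro L1_dist_triangle) auto
    ultimately show ?case using fy j elim by simp
  qed
  with h C show ?thesis by (intro that[of m h "\<lambda>i. C i j"]) auto
qed

lemma (in prob_space) integrable_unit_mult:
  fixes u v :: "'a \<Rightarrow> real"
  assumes "u \<in> borel_measurable M" "v \<in> borel_measurable M"
    and "\<And>\<omega>. \<omega> \<in> space M \<Longrightarrow> 0 \<le> u \<omega> \<and> u \<omega> \<le> 1" "\<And>\<omega>. \<omega> \<in> space M \<Longrightarrow> 0 \<le> v \<omega> \<and> v \<omega> \<le> 1"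
  shows "integrable M (\<lambda>\<omega>. u \<omega> * v \<omega>)"
proof (rule integrable_const_bound[where B=1])
  show "AE \<omega> in M. norm (u \<omega> * v \<omega>) \<le> 1"
    using assms(3,4) by (intro AE_I2) (simp add: abs_mult mult_le_one)
qed (use assms(1,2) in simp)

text \<open>The same elementary inequality for products in the unit interval is used twice,
  pointwise under the integral and for the means. Each use contributes the sum of the two mean
  distances once, whence the factor 2.\<close>

lemma (in prob_space) covariance_L1_bound:
  fixes f g F G :: "'a \<Rightarrow> real"
  assumes "f \<in> borel_measurable M" "g \<in> borel_measurable M" "F \<in> borel_measurable M" "G \<in> borel_measurable M"
    and f: "\<And>\<omega>. \<omega> \<in> space M \<Longrightarrow> 0 \<le> f \<omega> \<and> f \<omega> \<le> 1" and g: "\<And>\<omega>. \<omega> \<in> space M \<Longrightarrow> 0 \<le> g \<omega> \<and> g \<omega> \<le> 1"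
    and F: "\<And>\<omega>. \<omega> \<in> space M \<Longrightarrow> 0 \<le> F \<omega> \<and> F \<omega> \<le> 1" and G: "\<And>\<omega>. \<omega> \<in> space M \<Longrightarrow> 0 \<le> G \<omega> \<and> G \<omega> \<le> 1"
  shows "\<bar>((\<integral>\<omega>. f \<omega> * g \<omega> \<partial>M) - (\<integral>\<omega>. f \<omega> \<partial>M) * (\<integral>\<omega>. g \<omega> \<partial>M))
      - ((\<integral>\<omega>. F \<omega> * G \<omega> \<partial>M) - (\<integral>\<omega>. F \<omega> \<partial>M) * (\<integral>\<omega>. G \<omega> \<partial>M))\<bar>
    \<le> 2 * ((\<integral>\<omega>. \<bar>f \<omega> - F \<omega>\<bar> \<partial>M) + (\<integral>\<omega>. \<bar>g \<omega> - G \<omega>\<bar> \<partial>M))"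
proof -
  have prod: "\<bar>a * b - c * d\<bar> \<le> \<bar>a - c\<bar> + \<bar>b - d\<bar>"
    if "0 \<le> b \<and> b \<le> 1" "0 \<le> c \<and> c \<le> 1" for a b c d :: real
  proof -
    have "\<bar>a * b - c * d\<bar> = \<bar>(a - c) * b + c * (b - d)\<bar>" by (simp add: algebra_simps)
    also have "\<dots> \<le> \<bar>a - c\<bar> * b + c * \<bar>b - d\<bar>"
      using that by (intro order_trans[OF abs_triangle_ineq]) (simp add: abs_mult)
    also have "\<dots> \<le> \<bar>a - c\<bar> * 1 + 1 * \<bar>b - d\<bar>"
      using that by (intro add_mono mult_left_mono mult_right_mono) auto
    finally show ?thesis by simp
  qed
  have int[simp]: "integrable M f" "integrable M g" "integrable M F" "integrable M G"
    using assms by (auto intro!: integrable_const_bound[where B=1])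
  have int2[simp]: "integrable M (\<lambda>\<omega>. f \<omega> * g \<omega>)" "integrable M (\<lambda>\<omega>. F \<omega> * G \<omega>)"
    using assms by (auto intro!: integrable_unit_mult)
  let ?a = "\<integral>\<omega>. \<bar>f \<omega> - F \<omega>\<bar> \<partial>M" and ?b = "\<integral>\<omega>. \<bar>g \<omega> - G \<omega>\<bar> \<partial>M"
  have "\<bar>(\<integral>\<omega>. f \<omega> * g \<omega> \<partial>M) - (\<integral>\<omega>. F \<omega> * G \<omega> \<partial>M)\<bar> = \<bar>\<integral>\<omega>. f \<omega> * g \<omega> - F \<omega> * G \<omega> \<partial>M\<bar>"
    by simp
  also have "\<dots> \<le> (\<integral>\<omega>. \<bar>f \<omega> * g \<omega> - F \<omega> * G \<omega>\<bar> \<partial>M)" by (rule integral_abs_bound)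
  also have "\<dots> \<le> (\<integral>\<omega>. \<bar>f \<omega> - F \<omega>\<bar> + \<bar>g \<omega> - G \<omega>\<bar> \<partial>M)"
    using g F by (intro integral_mono prod) auto
  also have "\<dots> = ?a + ?b" by simp
  finally have 1: "\<bar>(\<integral>\<omega>. f \<omega> * g \<omega> \<partial>M) - (\<integral>\<omega>. F \<omega> * G \<omega> \<partial>M)\<bar> \<le> ?a + ?b" .
  have diff: "\<bar>(\<integral>\<omega>. u \<omega> \<partial>M) - (\<integral>\<omega>. v \<omega> \<partial>M)\<bar> \<le> (\<integral>\<omega>. \<bar>u \<omega> - v \<omega>\<bar> \<partial>M)"
    if "integrable M u" "integrable M v" for u v :: "'a \<Rightarrow> real"
    using integral_abs_bound[of M "\<lambda>\<omega>. u \<omega> - v \<omega>"] that by simp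
  have unit: "0 \<le> (\<integral>\<omega>. u \<omega> \<partial>M) \<and> (\<integral>\<omega>. u \<omega> \<partial>M) \<le> 1"
    if "integrable M u" "\<And>\<omega>. \<omega> \<in> space M \<Longrightarrow> 0 \<le> u \<omega> \<and> u \<omega> \<le> 1" for u :: "'a \<Rightarrow> real"
    using that by (auto intro!: integral_nonneg_AE AE_I2 integral_le_const)
  have "\<bar>(\<integral>\<omega>. f \<omega> \<partial>M) * (\<integral>\<omega>. g \<omega> \<partial>M) - (\<integral>\<omega>. F \<omega> \<partial>M) * (\<integral>\<omega>. G \<omega> \<partial>M)\<bar>
     \<le> \<bar>(\<integral>\<omega>. f \<omega> \<partial>M) - (\<integral>\<omega>. F \<omega> \<partial>M)\<bar> + \<bar>(\<integral>\<omega>. g \<omega> \<partial>M) - (\<integral>\<omega>. G \<omega> \<partial>M)\<bar>"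
    by (intro prod unit int g F)
  also have "\<dots> \<le> ?a + ?b" by (intro add_mono diff int)
  finally have 2: "\<bar>(\<integral>\<omega>. f \<omega> \<partial>M) * (\<integral>\<omega>. g \<omega> \<partial>M) - (\<integral>\<omega>. F \<omega> \<partial>M) * (\<integral>\<omega>. G \<omega> \<partial>M)\<bar> \<le> ?a + ?b" .
  have "\<bar>(p - q) - (p' - q')\<bar> \<le> 2 * r" if "\<bar>p - p'\<bar> \<le> r" "\<bar>q - q'\<bar> \<le> r" for p q p' q' r :: real
    using that by linarith
  from this[OF 1 2] show ?thesis .
qed

subsection \<open>Covariances and the limit\<close>

definition covar :: "'b measure \<Rightarrow> ('b \<Rightarrow> 'c) \<Rightarrow> ('c \<Rightarrow> real) \<Rightarrow> ('c \<Rightarrow> real) \<Rightarrow> real" where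
  "covar \<Omega> X f g = (\<integral>\<omega>. f (X \<omega>) * g (X \<omega>) \<partial>\<Omega>) - (\<integral>\<omega>. f (X \<omega>) \<partial>\<Omega>) * (\<integral>\<omega>. g (X \<omega>) \<partial>\<Omega>)"

text \<open>Finite unions of the compact sets are disjoint and compact, hence a positive distance
  apart, and the supports reach out by less than 1/(k+1). Finiteness of the unions is essential:
  infinitely many compact subsets of \<open>A\<close> and \<open>B\<close> may come arbitrarily
  close to each other.\<close>

lemma bump_supports_eventually_disjoint:
  fixes C D :: "nat \<Rightarrow> 'a::metric_space set"
  assumes C: "\<And>i. compact (C i)" "\<And>i. C i \<subseteq> A" and D: "\<And>i. compact (D i)" "\<And>i. D i \<subseteq> B"
    and AB: "A \<inter> B = {}"
  shows "\<forall>\<^sub>F k in sequentially.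
    (\<Union>i<m. {x. bump (C i) k x \<noteq> 0}) \<inter> (\<Union>i<n. {x. bump (D i) k x \<noteq> 0}) = {}"
proof -
  have "compact (\<Union>i<m. C i)" "compact (\<Union>i<n. D i)"
    using C(1) D(1) by (auto intro!: compact_UN)
  moreover have "(\<Union>i<m. C i) \<inter> (\<Union>i<n. D i) = {}" using C(2) D(2) AB by blast
  ultimately obtain d where d: "0 < d" "\<And>x y. x \<in> (\<Union>i<m. C i) \<Longrightarrow> y \<in> (\<Union>i<n. D i) \<Longrightarrow> d \<le> dist x y"
    using compact_closed_separation compact_imp_closed by metis
  have "(\<lambda>k. 1 / real (Suc k)) \<longlonglongrightarrow> 0"
    using LIMSEQ_inverse_real_of_nat by (simp only: inverse_eq_divide)
  then have "\<forall>\<^sub>F k in sequentially. 1 / real (Suc k) < d / 2"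
    using d(1) by (intro order_tendstoD(2)) auto
  then show ?thesis
  proof eventually_elim
    case (elim k)
    show ?case
    proof (rule ccontr)
      assume "\<not> ?thesis"
      then obtain x i j where x: "i < m" "j < n" "bump (C i) k x \<noteq> 0" "bump (D j) k x \<noteq> 0" by blast
      obtain p where p: "p \<in> C i" "dist x p < 1 / real (Suc k)" using bump_nonzeroD[OF x(3)] .
      obtain q where q: "q \<in> D j" "dist x q < 1 / real (Suc k)" using bump_nonzeroD[OF x(4)] .
      have "d \<le> dist p q" using p(1) q(1) x(1,2) by (intro d(2)) auto
      also have "\<dots> \<le> dist x p + dist x q" by (metis dist_commute dist_triangle)
      also have "\<dots> < d" using p(2) q(2) elim by simp
      finally show False by simp
    qed
  qed
qed

text \<open>The product of two bounded vaguely continuous functionals is again one, so the mean of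
  the product converges along with the two means.\<close>

lemma conv_distr_covar:
  assumes "conv_distr \<Omega>s Xs \<Omega> X"
    and F: "continuous_map vague_topology euclideanreal F" "\<And>\<mu>. \<mu> \<in> locfin_measures \<Longrightarrow> \<bar>F \<mu>\<bar> \<le> 1"
    and G: "continuous_map vague_topology euclideanreal G" "\<And>\<mu>. \<mu> \<in> locfin_measures \<Longrightarrow> \<bar>G \<mu>\<bar> \<le> 1"
  shows "(\<lambda>n. covar (\<Omega>s n) (Xs n) F G) \<longlonglongrightarrow> covar \<Omega> X F G"
proof -
  have lim: "(\<lambda>n. \<integral>\<omega>. H (Xs n \<omega>) \<partial>(\<Omega>s n)) \<longlonglongrightarrow> (\<integral>\<omega>. H (X \<omega>) \<partial>\<Omega>)"
    if "continuous_map vague_topology euclideanreal H" "\<And>\<mu>. \<mu> \<in> locfin_measures \<Longrightarrow> \<bar>H \<mu>\<bar> \<le> 1" for H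
    using assms(1) that unfolding conv_distr_def by blast
  have "(\<lambda>n. \<integral>\<omega>. F (Xs n \<omega>) * G (Xs n \<omega>) \<partial>(\<Omega>s n)) \<longlonglongrightarrow> (\<integral>\<omega>. F (X \<omega>) * G (X \<omega>) \<partial>\<Omega>)"
  proof (rule lim[of "\<lambda>\<mu>. F \<mu> * G \<mu>"])
    show "continuous_map vague_topology euclideanreal (\<lambda>\<mu>. F \<mu> * G \<mu>)"
      using F(1) G(1) by (rule continuous_map_real_mult)
    show "\<bar>F \<mu> * G \<mu>\<bar> \<le> 1" if "\<mu> \<in> locfin_measures" for \<mu>
      using mult_mono[OF F(2)[OF that] G(2)[OF that]] by (simp add: abs_mult)
  qed
  then show ?thesis
    unfolding covar_def using lim[OF F] lim[OF G] by (intro tendsto_diff tendsto_mult)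
qed

text \<open>The sign s = 1 covers positive and s = -1 negative association; the sets A' and B' are
  the open supports of the approximating functionals, which are disjoint only when A and B are.\<close>

lemma covar_sign_limit_unit:
  fixes \<Omega>s :: "nat \<Rightarrow> 'b measure" and Xs :: "nat \<Rightarrow> 'b \<Rightarrow> ('a::polish_space) measure"
    and \<Omega> :: "'c measure" and X :: "'c \<Rightarrow> 'a measure" and s :: real
  assumes X: "random_measure \<Omega> X" and conv: "conv_distr \<Omega>s Xs \<Omega> X" and s: "\<bar>s\<bar> = 1"
    and f: "bdd_mono_functional f" "\<And>\<mu>. \<mu> \<in> locfin_measures \<Longrightarrow> 0 \<le> f \<mu> \<and> f \<mu> \<le> 1"
    and g: "bdd_mono_functional g" "\<And>\<mu>. \<mu> \<in> locfin_measures \<Longrightarrow> 0 \<le> g \<mu> \<and> g \<mu> \<le> 1"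
    and A: "A \<in> sets borel" "functional_on f A" and B: "B \<in> sets borel" "functional_on g B"
    and sign: "\<And>n F G A' B'. 1 \<le> n \<Longrightarrow> bdd_mono_functional F \<Longrightarrow> bdd_mono_functional G \<Longrightarrow>
      A' \<in> sets borel \<Longrightarrow> B' \<in> sets borel \<Longrightarrow> (A \<inter> B = {} \<Longrightarrow> A' \<inter> B' = {}) \<Longrightarrow>
      functional_on F A' \<Longrightarrow> functional_on G B' \<Longrightarrow> 0 \<le> s * covar (\<Omega>s n) (Xs n) F G"
  shows "0 \<le> s * covar \<Omega> X f g"
proof (rule field_le_epsilon)
  fix e :: real assume "0 < e"
  \<comment> \<open>Two approximations of error e/4 each enter \<open>covariance_L1_bound\<close>
    with factor 2, for a total below \<open>e\<close>.\<close>
  then have e: "0 < e / 4" by simp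
  note XD = random_measureD[OF X]
  interpret prob_space \<Omega> by (rule XD(1))
  obtain m h C where h: "mono_cylinder m h" and C: "\<And>i. compact (C i)" "\<And>i. C i \<subseteq> A"
    and fC: "\<forall>\<^sub>F k in sequentially. (\<integral>\<omega>. \<bar>f (X \<omega>) - bump_functional h C k (X \<omega>)\<bar> \<partial>\<Omega>) < e / 4"
  proof (rule functional_on_bump_approx[OF X f(1) _ A e])
    show "0 \<le> f \<mu> \<and> f \<mu> \<le> 1" if "\<mu> \<in> locfin_measures" for \<mu> using that by (rule f(2))
  qed (rule that)
  obtain m' h' D where h': "mono_cylinder m' h'" and D: "\<And>i. compact (D i)" "\<And>i. D i \<subseteq> B"
    and gD: "\<forall>\<^sub>F k in sequentially. (\<integral>\<omega>. \<bar>g (X \<omega>) - bump_functional h' D k (X \<omega>)\<bar> \<partial>\<Omega>) < e / 4"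
  proof (rule functional_on_bump_approx[OF X g(1) _ B e])
    show "0 \<le> g \<mu> \<and> g \<mu> \<le> 1" if "\<mu> \<in> locfin_measures" for \<mu> using that by (rule g(2))
  qed (rule that)
  define A' where "A' k = (\<Union>i<m. {x. bump (C i) k x \<noteq> 0})" for k
  define B' where "B' k = (\<Union>i<m'. {x. bump (D i) k x \<noteq> 0})" for k
  have "\<forall>\<^sub>F k in sequentially. A \<inter> B = {} \<longrightarrow> A' k \<inter> B' k = {}"
  proof (cases "A \<inter> B = {}")
    case True
    show ?thesis
      unfolding A'_def B'_def
      using bump_supports_eventually_disjoint[where C=C and D=D and m=m and n=m', OF C D True] by eventually_elim simp
  qed simp
  with fC gD have "\<forall>\<^sub>F k in sequentially. (\<integral>\<omega>. \<bar>f (X \<omega>) - bump_functional h C k (X \<omega>)\<bar> \<partial>\<Omega>) < e / 4 \<and>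
     (\<integral>\<omega>. \<bar>g (X \<omega>) - bump_functional h' D k (X \<omega>)\<bar> \<partial>\<Omega>) < e / 4 \<and> (A \<inter> B = {} \<longrightarrow> A' k \<inter> B' k = {})"
    by eventually_elim simp
  then obtain k where k: "(\<integral>\<omega>. \<bar>f (X \<omega>) - bump_functional h C k (X \<omega>)\<bar> \<partial>\<Omega>) < e / 4"
     "(\<integral>\<omega>. \<bar>g (X \<omega>) - bump_functional h' D k (X \<omega>)\<bar> \<partial>\<Omega>) < e / 4"
     "A \<inter> B = {} \<Longrightarrow> A' k \<inter> B' k = {}"
    using eventually_happens'[OF sequentially_bot] by blast
  define F where "F = bump_functional h C k"
  define G where "G = bump_functional h' D k"
  have AB': "A' k \<in> sets borel" "B' k \<in> sets borel"
    unfolding A'_def B'_def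
    using vague_test_funD(3)[OF vague_test_fun_bump[OF compact_imp_bounded[OF C(1)]]]
      vague_test_funD(3)[OF vague_test_fun_bump[OF compact_imp_bounded[OF D(1)]]]
    by (auto intro!: sets.finite_UN)
  have F: "bdd_mono_functional F" "functional_on F (A' k)" "continuous_map vague_topology euclideanreal F"
    "0 \<le> F \<mu>" "F \<mu> \<le> 1" for \<mu>
    unfolding F_def using mono_cylinderD(2,3)[OF h] AB'(1)
    by (auto intro!: bump_functional_bdd_mono[OF h C(1)] bump_functional_on[OF h C(1)]
        bump_functional_vague_continuous[OF h C(1)] simp: A'_def) (auto simp: bump_functional_def)
  have G: "bdd_mono_functional G" "functional_on G (B' k)" "continuous_map vague_topology euclideanreal G"
    "0 \<le> G \<mu>" "G \<mu> \<le> 1" for \<mu>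
    unfolding G_def using mono_cylinderD(2,3)[OF h'] AB'(2)
    by (auto intro!: bump_functional_bdd_mono[OF h' D(1)] bump_functional_on[OF h' D(1)]
        bump_functional_vague_continuous[OF h' D(1)] simp: B'_def) (auto simp: bump_functional_def)
  \<comment> \<open>\<open>F\<close> and \<open>G\<close> were fixed from the law of the limit
    alone, so they stay unchanged while \<open>n\<close> tends to infinity.\<close>
  have "(\<lambda>n. s * covar (\<Omega>s n) (Xs n) F G) \<longlonglongrightarrow> s * covar \<Omega> X F G"
    using F(4,5) G(4,5) by (intro tendsto_mult_left conv_distr_covar[OF conv] F(3) G(3)) auto
  moreover have "\<forall>n\<ge>1. 0 \<le> s * covar (\<Omega>s n) (Xs n) F G"
    by (intro allI impI sign[where A'="A' k" and B'="B' k"] F(1,2) G(1,2) AB' k(3))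
  ultimately have nn: "0 \<le> s * covar \<Omega> X F G"
    by (intro LIMSEQ_le_const) auto
  have meas: "(\<lambda>\<omega>. H (X \<omega>)) \<in> borel_measurable \<Omega>" if "bdd_mono_functional H" for H
    using that measurable_compose[OF XD(2), of H borel] by (simp add: bdd_mono_functional_def)
  have "\<bar>covar \<Omega> X f g - covar \<Omega> X F G\<bar>
     \<le> 2 * ((\<integral>\<omega>. \<bar>f (X \<omega>) - F (X \<omega>)\<bar> \<partial>\<Omega>) + (\<integral>\<omega>. \<bar>g (X \<omega>) - G (X \<omega>)\<bar> \<partial>\<Omega>))"
    unfolding covar_def using f(2) g(2) XD(3) F(4,5) G(4,5)
    by (intro covariance_L1_bound meas f(1) g(1) F(1) G(1)) auto
  also have "\<dots> < e" using k(1,2) by (simp add: F_def G_def)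
  finally have "\<bar>s * covar \<Omega> X f g - s * covar \<Omega> X F G\<bar> < e"
    using s by (simp add: right_diff_distrib[symmetric] abs_mult)
  then show "0 \<le> s * covar \<Omega> X f g + e" using nn by linarith
qed

lemma bdd_mono_functional_rescale:
  assumes "bdd_mono_functional f"
  obtains c where "0 < c" "bdd_mono_functional (\<lambda>\<mu>. (f \<mu> + c) / (2 * c))"
    "\<And>\<mu>. \<mu> \<in> locfin_measures \<Longrightarrow> 0 \<le> (f \<mu> + c) / (2 * c) \<and> (f \<mu> + c) / (2 * c) \<le> 1"
proof -
  obtain C where C: "\<And>\<mu>. \<mu> \<in> locfin_measures \<Longrightarrow> \<bar>f \<mu>\<bar> \<le> C"
    using assms unfolding bdd_mono_functional_def by blast
  \<comment> \<open>The maximum with 1 keeps the divisor positive when the bound \<open>C\<close> is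
    0; the affine map then sends the interval from -c to c onto the unit interval.\<close>
  define c where "c = max C 1"
  have c: "0 < c" by (simp add: c_def)
  have unit: "0 \<le> (f \<mu> + c) / (2 * c) \<and> (f \<mu> + c) / (2 * c) \<le> 1" if "\<mu> \<in> locfin_measures" for \<mu>
  proof -
    have "\<bar>f \<mu>\<bar> \<le> c" using C[OF that] by (simp add: c_def)
    then show ?thesis using c by (simp add: field_simps abs_le_iff)
  qed
  have "bdd_mono_functional (\<lambda>\<mu>. (f \<mu> + c) / (2 * c))"
    unfolding bdd_mono_functional_def
  proof (intro conjI exI[of _ 1] ballI impI)
    show "(\<lambda>\<mu>. (f \<mu> + c) / (2 * c)) \<in> borel_measurable RM_space"
      using assms unfolding bdd_mono_functional_def
      by (intro borel_measurable_divide borel_measurable_add borel_measurable_const) auto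
    show "\<bar>(f \<mu> + c) / (2 * c)\<bar> \<le> 1" if "\<mu> \<in> locfin_measures" for \<mu>
      using unit[OF that] by (metis abs_of_nonneg)
    show "(f \<mu> + c) / (2 * c) \<le> (f \<nu> + c) / (2 * c)"
      if "\<mu> \<in> locfin_measures" "\<nu> \<in> locfin_measures" "meas_le \<mu> \<nu>" for \<mu> \<nu>
      using assms that c by (auto simp: bdd_mono_functional_def intro!: divide_right_mono)
  qed
  with c show ?thesis using unit by (rule that)
qed

text \<open>Covariance ignores additive constants and is bilinear, so the affine passage to
  functionals with values in the unit interval multiplies it by a positive constant: undoing the
  passage gives the factor 4 * c * d and keeps the sign.\<close>

lemma covar_sign_limit:
  fixes \<Omega>s :: "nat \<Rightarrow> 'b measure" and Xs :: "nat \<Rightarrow> 'b \<Rightarrow> ('a::polish_space) measure"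
    and \<Omega> :: "'c measure" and X :: "'c \<Rightarrow> 'a measure" and s :: real
  assumes X: "random_measure \<Omega> X" and conv: "conv_distr \<Omega>s Xs \<Omega> X" and s: "\<bar>s\<bar> = 1"
    and f: "bdd_mono_functional f" and g: "bdd_mono_functional g"
    and A: "A \<in> sets borel" "functional_on f A" and B: "B \<in> sets borel" "functional_on g B"
    and sign: "\<And>n F G A' B'. 1 \<le> n \<Longrightarrow> bdd_mono_functional F \<Longrightarrow> bdd_mono_functional G \<Longrightarrow>
      A' \<in> sets borel \<Longrightarrow> B' \<in> sets borel \<Longrightarrow> (A \<inter> B = {} \<Longrightarrow> A' \<inter> B' = {}) \<Longrightarrow>
      functional_on F A' \<Longrightarrow> functional_on G B' \<Longrightarrow> 0 \<le> s * covar (\<Omega>s n) (Xs n) F G"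
  shows "0 \<le> s * covar \<Omega> X f g"
proof -
  note XD = random_measureD[OF X]
  interpret prob_space \<Omega> by (rule XD(1))
  obtain c where c: "0 < c" "bdd_mono_functional (\<lambda>\<mu>. (f \<mu> + c) / (2 * c))"
    "\<And>\<mu>. \<mu> \<in> locfin_measures \<Longrightarrow> 0 \<le> (f \<mu> + c) / (2 * c) \<and> (f \<mu> + c) / (2 * c) \<le> 1"
    by (rule bdd_mono_functional_rescale[OF f]) (rule that)
  obtain d where d: "0 < d" "bdd_mono_functional (\<lambda>\<mu>. (g \<mu> + d) / (2 * d))"
    "\<And>\<mu>. \<mu> \<in> locfin_measures \<Longrightarrow> 0 \<le> (g \<mu> + d) / (2 * d) \<and> (g \<mu> + d) / (2 * d) \<le> 1"
    by (rule bdd_mono_functional_rescale[OF g]) (rule that)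
  define p where "p \<mu> = (f \<mu> + c) / (2 * c)" for \<mu>
  define q where "q \<mu> = (g \<mu> + d) / (2 * d)" for \<mu>
  have pq: "functional_on p A" "functional_on q B"
    using A(2) B(2) by (auto simp: functional_on_def p_def q_def)
  have nn: "0 \<le> s * covar \<Omega> X p q"
    by (rule covar_sign_limit_unit[OF X conv s, where A=A and B=B])
       (use c d pq A(1) B(1) sign in \<open>auto simp: p_def[abs_def] q_def[abs_def]\<close>)
  have meas: "(\<lambda>\<omega>. H (X \<omega>)) \<in> borel_measurable \<Omega>" if "bdd_mono_functional H" for H
    using that measurable_compose[OF XD(2), of H borel] by (simp add: bdd_mono_functional_def)
  have pm: "(\<lambda>\<omega>. p (X \<omega>)) \<in> borel_measurable \<Omega>" "(\<lambda>\<omega>. q (X \<omega>)) \<in> borel_measurable \<Omega>"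
    using meas[OF c(2)] meas[OF d(2)] by (simp_all add: p_def q_def)
  have bound: "0 \<le> p (X \<omega>)" "p (X \<omega>) \<le> 1" "0 \<le> q (X \<omega>)" "q (X \<omega>) \<le> 1" if "\<omega> \<in> space \<Omega>" for \<omega>
    using c(3)[OF XD(3)[OF that]] d(3)[OF XD(3)[OF that]] by (simp_all add: p_def q_def)
  have [simp]: "integrable \<Omega> (\<lambda>\<omega>. p (X \<omega>))" "integrable \<Omega> (\<lambda>\<omega>. q (X \<omega>))"
    using bound pm by (auto intro!: integrable_const_bound[where B=1])
  have [simp]: "integrable \<Omega> (\<lambda>\<omega>. p (X \<omega>) * q (X \<omega>))"
    by (rule integrable_unit_mult[OF pm]) (use bound in auto)
  have fg: "f = (\<lambda>\<mu>. 2 * c * p \<mu> - c)" "g = (\<lambda>\<mu>. 2 * d * q \<mu> - d)"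
    using c(1) d(1) by (auto simp: p_def q_def fun_eq_iff field_simps)
  have "(\<integral>\<omega>. f (X \<omega>) * g (X \<omega>) \<partial>\<Omega>) = (\<integral>\<omega>. 4 * c * d * (p (X \<omega>) * q (X \<omega>))
      - 2 * c * d * p (X \<omega>) - 2 * c * d * q (X \<omega>) + c * d \<partial>\<Omega>)"
    by (intro Bochner_Integration.integral_cong) (auto simp: fg algebra_simps)
  also have "\<dots> = 4 * c * d * (\<integral>\<omega>. p (X \<omega>) * q (X \<omega>) \<partial>\<Omega>) - 2 * c * d * (\<integral>\<omega>. p (X \<omega>) \<partial>\<Omega>)
      - 2 * c * d * (\<integral>\<omega>. q (X \<omega>) \<partial>\<Omega>) + c * d"
    by (simp add: prob_space)
  finally have 1: "(\<integral>\<omega>. f (X \<omega>) * g (X \<omega>) \<partial>\<Omega>) = \<dots>" .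
  have 2: "(\<integral>\<omega>. f (X \<omega>) \<partial>\<Omega>) = 2 * c * (\<integral>\<omega>. p (X \<omega>) \<partial>\<Omega>) - c"
    "(\<integral>\<omega>. g (X \<omega>) \<partial>\<Omega>) = 2 * d * (\<integral>\<omega>. q (X \<omega>) \<partial>\<Omega>) - d"
    by (simp_all add: fg prob_space)
  have "covar \<Omega> X f g = 4 * c * d * covar \<Omega> X p q"
    unfolding covar_def 1 2 by (simp add: algebra_simps)
  then have "s * covar \<Omega> X f g = 4 * c * d * (s * covar \<Omega> X p q)" by simp
  moreover have "0 \<le> 4 * c * d * (s * covar \<Omega> X p q)"
    using c(1) d(1) by (intro mult_nonneg_nonneg[of "4 * c * d"] nn) simp
  ultimately show ?thesis by (simp only:)
qed

theorem theorem4p6: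
  fixes \<Omega>s :: "nat \<Rightarrow> 'b measure" and Ms :: "nat \<Rightarrow> 'b \<Rightarrow> ('a::polish_space) measure"
    and \<Omega> :: "'c measure" and M :: "'c \<Rightarrow> 'a measure"
  assumes "\<And>n. n \<ge> 1 \<Longrightarrow> random_measure (\<Omega>s n) (Ms n)"
    and "random_measure \<Omega> M"
    and "conv_distr \<Omega>s Ms \<Omega> M"
  shows "((\<forall>n\<ge>1. neg_assoc (\<Omega>s n) (Ms n)) \<longrightarrow> neg_assoc \<Omega> M) \<and>
     ((\<forall>n\<ge>1. pos_assoc (\<Omega>s n) (Ms n)) \<longrightarrow> pos_assoc \<Omega> M)"
proof (intro conjI impI)
  assume neg: "\<forall>n\<ge>1. neg_assoc (\<Omega>s n) (Ms n)"
  show "neg_assoc \<Omega> M"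
    unfolding neg_assoc_def
  proof (intro allI impI, elim conjE)
    fix f g :: "'a measure \<Rightarrow> real" and A B :: "'a set"
    assume fg: "bdd_mono_functional f" "bdd_mono_functional g" "A \<in> sets borel" "B \<in> sets borel"
      "A \<inter> B = {}" "functional_on f A" "functional_on g B"
    have "0 \<le> (- 1) * covar \<Omega> M f g"
    proof (rule covar_sign_limit[OF assms(2,3) _ fg(1,2,3,6,4,7)])
      fix n :: nat and F G :: "'a measure \<Rightarrow> real" and A' B' :: "'a set"
      assume n: "1 \<le> n" and FG: "bdd_mono_functional F" "bdd_mono_functional G"
        "A' \<in> sets borel" "B' \<in> sets borel" "A \<inter> B = {} \<Longrightarrow> A' \<inter> B' = {}"
        "functional_on F A'" "functional_on G B'"
      have "(\<integral>\<omega>. F (Ms n \<omega>) * G (Ms n \<omega>) \<partial>\<Omega>s n) \<le> (\<integral>\<omega>. F (Ms n \<omega>) \<partial>\<Omega>s n) * (\<integral>\<omega>. G (Ms n \<omega>) \<partial>\<Omega>s n)"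
        using neg[rule_format, OF n, unfolded neg_assoc_def] FG fg(5) by blast
      then show "0 \<le> (- 1) * covar (\<Omega>s n) (Ms n) F G"
        by (simp add: covar_def)
    qed simp
    then show "(\<integral>\<omega>. f (M \<omega>) * g (M \<omega>) \<partial>\<Omega>) \<le> (\<integral>\<omega>. f (M \<omega>) \<partial>\<Omega>) * (\<integral>\<omega>. g (M \<omega>) \<partial>\<Omega>)"
      by (simp add: covar_def)
  qed
next
  assume pos: "\<forall>n\<ge>1. pos_assoc (\<Omega>s n) (Ms n)"
  \<comment> \<open>Positive association is the case where both sets are the whole space: every
    functional is measurable with respect to it, and the disjointness clause of
    \<open>covar_sign_limit\<close> becomes vacuous.\<close>
  have on_UNIV: "functional_on f UNIV" for f :: "'a measure \<Rightarrow> real"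
    by (simp add: functional_on_def restr_meas_def density_1[unfolded one_ereal_def])
  show "pos_assoc \<Omega> M"
    unfolding pos_assoc_def
  proof (intro allI impI, elim conjE)
    fix f g :: "'a measure \<Rightarrow> real"
    assume fg: "bdd_mono_functional f" "bdd_mono_functional g"
    have "0 \<le> 1 * covar \<Omega> M f g"
    proof (rule covar_sign_limit[OF assms(2,3) _ fg _ on_UNIV _ on_UNIV])
      fix n :: nat and F G :: "'a measure \<Rightarrow> real"
      assume "1 \<le> n" "bdd_mono_functional F" "bdd_mono_functional G"
      then show "0 \<le> 1 * covar (\<Omega>s n) (Ms n) F G"
        using pos unfolding pos_assoc_def covar_def by auto
    qed simp_all
    then show "(\<integral>\<omega>. f (M \<omega>) * g (M \<omega>) \<partial>\<Omega>) \<ge> (\<integral>\<omega>. f (M \<omega>) \<partial>\<Omega>) * (\<integral>\<omega>. g (M \<omega>) \<partial>\<Omega>)"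
      by (simp add: covar_def)
  qed
qed

end
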